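(* Suppose that the $n\times p$ design matrix $X$ satisfies the coherence property. Let $p\ge128$, let $\eta$ be distributed as $\mathcal{CN}(\mathbf 0,\sigma^2I)$, and let $y=X\beta+\eta$. Fix a parameter $t\in(0,1)$ and choose the threshold $$\lambda=\max\Big\{\tfrac{1}{t}\,10\,\mu\sqrt{n\cdot \mathrm{SNR}},\ \tfrac{1}{1-t}\sqrt{2}\Big\}\sqrt{2\sigma^2\log p},\qquad\mu=\mu(X).$$ Then, under the assumption that $k\le n/(2\log p)$, the OST algorithm with threshold $\lambda$ guarantees with probability exceeding $1-6p^{-1}$ that $\widehat{\mathcal S}\subset\mathcal S$ and $|\mathcal S\setminus\widehat{\mathcal S}|\le k-M$, where $M$ is the largest integer for which $$\mathrm{LAR}_M>\max\Bigg\{8(1-t)^{-2}\Big(\frac{2k\log p}{n\cdot\mathrm{SNR}}\Big),\ 400\,t^{-2}\Big(\frac{2k\log p}{\mu^{-2}}\Big)\Bigg\}.$$ Here the probability is with respect to the true model $\mathcal S$ and the noise vector $\eta$.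
   Context: Setting. $k<n\le p$ are positive integers, $X$ is a fixed real- or complex-valued $n\times p$ matrix whose columns $\mathrm{x}_1,\dots,\mathrm{x}_p$ have unit $\ell_2$-norm, and $\log$ is the natural logarithm. The noise $\eta\in\mathbb C^n$ has i.i.d. circularly symmetric complex Gaussian entries of variance $\sigma^2>0$ (so $\mathbb E\|\eta\|_2^2=n\sigma^2$). Signal model. The signal $\beta\in\mathbb C^p$ is $k$-sparse with uniformly random support: there are a fixed vector $z\in\mathbb C^k$ with all entries nonzero and a uniformly random permutation $(\pi_1,\dots,\pi_p)$ of $\{1,\dots,p\}$, independent of $\eta$, with $\beta_{\pi_i}=z_i$ for $i\le k$ and all other entries of $\beta$ equal to $0$. The true model is $\mathcal S=\{i:|\beta_i|>0\}=\{\pi_1,\dots,\pi_k\}$. Coherence. $\mu(X)=\max_{i\ne j}|\langle \mathrm{x}_i,\mathrm{x}_j\rangle|$ and $\nu(X)=\frac1{p-1}\max_i\big|\sum_{j\neq i}\langle \mathrm{x}_i,\mathrm{x}_j\rangle\big|$. $X$ satisfies the coherence property if $\mu(X)\le \frac{0.1}{\sqrt{2\log p}}$ and $\nu(X)\le \frac{\mu(X)}{\sqrt n}$. The expression $a/\mu^{-2}$ means $a\mu^2$. Signal quantities. $\mathrm{SNR}=\frac{\|\beta\|_2^2}{\mathbb E[\|\eta\|_2^2]}$. For $m\in\{1,\dots,k\}$, the $m$-th largest-to-average ratio is $\mathrm{LAR}_m=\frac{|\beta_{(m)}|^2}{\|\beta\|_2^2/k}$, where $\beta_{(m)}$ is the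 $m$-th largest (in magnitude) nonzero entry of $\beta$. If the inequality defining $M$ holds for no $m\in\{1,\dots,k\}$, take $M=0$. OST algorithm (one-step thresholding). Given $X$, $y$ and $\lambda>0$: compute $f=X^{\mathrm H}y$ and output $\widehat{\mathcal S}=\{i\in\{1,\dots,p\}:|f_i|>\lambda\}$. *)

theory Defs
  imports "HOL-Probability.Probability" "HOL-Library.Multiset"
begin

text \<open>
  The library inner product on \<open>complex ^ 'n\<close> is the real one; the coherence measures need the
  Hermitian one. The library norm on \<open>complex ^ 'n\<close> is the Euclidean norm.
\<close>

definition hinner :: "complex ^ 'n \<Rightarrow> complex ^ 'n \<Rightarrow> complex" where
  "hinner x y = (\<Sum>i\<in>UNIV. cnj (x $ i) * y $ i)"

definition conj_transpose :: "complex ^ 'p ^ 'n \<Rightarrow> complex ^ 'n ^ 'p" where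
  "conj_transpose X = (\<chi> i j. cnj (X $ j $ i))"

definition worst_case_coherence :: "complex ^ 'p ^ 'n \<Rightarrow> real" where
  "worst_case_coherence X =
     Max {cmod (hinner (column i X) (column j X)) | i j. i \<noteq> j}"

definition average_coherence :: "complex ^ 'p ^ 'n \<Rightarrow> real" where
  "average_coherence X =
     1 / (real CARD('p) - 1) *
     (MAX i. cmod (\<Sum>j\<in>UNIV - {i}. hinner (column i X) (column j X)))"

definition coherence_property :: "complex ^ 'p ^ 'n \<Rightarrow> bool" where
  "coherence_property X \<longleftrightarrow>
     worst_case_coherence X \<le> 0.1 / sqrt (2 * ln (real CARD('p))) \<and>
     average_coherence X \<le> worst_case_coherence X / sqrt (real CARD('n))"

definition model_support :: "complex ^ 'p \<Rightarrow> 'p set" where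
  "model_support b = {i. cmod (b $ i) > 0}"

definition snr :: "'a measure \<Rightarrow> ('a \<Rightarrow> complex ^ 'n) \<Rightarrow> complex ^ 'p \<Rightarrow> real" where
  "snr M \<eta> b = (norm b)\<^sup>2 / (\<integral>\<omega>. (norm (\<eta> \<omega>))\<^sup>2 \<partial>M)"

text \<open>
  Magnitude of the \<open>m\<close>-th largest nonzero entry, \<open>m\<close> counted from 1. Entries are counted with
  multiplicity, hence the multiset; the value is meaningful for
  \<open>1 \<le> m \<le> card (model_support b)\<close>.
\<close>

definition mth_largest :: "complex ^ 'p \<Rightarrow> nat \<Rightarrow> real" where
  "mth_largest b m =
     rev (sorted_list_of_multiset {#cmod (b $ i). i \<in># mset_set (model_support b)#}) ! (m - 1)"

definition LAR :: "nat \<Rightarrow> complex ^ 'p \<Rightarrow> nat \<Rightarrow> real" where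
  "LAR k b m = (mth_largest b m)\<^sup>2 / ((norm b)\<^sup>2 / real k)"

definition OST :: "complex ^ 'p ^ 'n \<Rightarrow> complex ^ 'n \<Rightarrow> real \<Rightarrow> 'p set" where
  "OST X y l = {i. cmod ((conj_transpose X *v y) $ i) > l}"

text \<open>
  Permutations \<open>(\<pi>\<^sub>1, \<dots>, \<pi>\<^sub>p)\<close> of the \<open>p = CARD('p)\<close> column indices, as bijections from the positions
  \<open>{1..p}\<close> onto the index type (extensional, so that each permutation occurs exactly once).
\<close>

definition index_perms :: "(nat \<Rightarrow> 'p::finite) set" where
  "index_perms =
     {f \<in> {1..CARD('p)} \<rightarrow>\<^sub>E (UNIV :: 'p set). bij_betw f {1..CARD('p)} (UNIV :: 'p set)}"

context prob_space
begin

text \<open>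
  The library's \<open>indep_var\<close> requires both random variables to have the same value type. This is the
  same notion, with the generated \<open>\<sigma>\<close>-algebras spelled out, for different value types.
\<close>

definition indep_rvs ::
  "'b measure \<Rightarrow> ('a \<Rightarrow> 'b) \<Rightarrow> 'c measure \<Rightarrow> ('a \<Rightarrow> 'c) \<Rightarrow> bool" where
  "indep_rvs N Y N' Y' \<longleftrightarrow>
     random_variable N Y \<and> random_variable N' Y' \<and>
     indep_set {Y -` A \<inter> space M | A. A \<in> sets N} {Y' -` A \<inter> space M | A. A \<in> sets N'}"

definition uniform_perm :: "('a \<Rightarrow> nat \<Rightarrow> 'p::finite) \<Rightarrow> bool" where
  "uniform_perm \<pi> \<longleftrightarrow>
     random_variable (count_space index_perms) \<pi> \<and>
     distr M (count_space index_perms) \<pi> = uniform_count_measure index_perms"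

text \<open>
  Circularly symmetric complex Gaussian of variance \<open>\<sigma>\<^sup>2\<close>: real and imaginary parts are independent
  and each is normal with mean 0 and variance \<open>\<sigma>\<^sup>2 / 2\<close> (\<open>normal_density\<close> takes the standard
  deviation).
\<close>

definition circular_gaussian :: "real \<Rightarrow> ('a \<Rightarrow> complex) \<Rightarrow> bool" where
  "circular_gaussian \<sigma> Z \<longleftrightarrow>
     indep_var borel (\<lambda>\<omega>. Re (Z \<omega>)) borel (\<lambda>\<omega>. Im (Z \<omega>)) \<and>
     distributed M lborel (\<lambda>\<omega>. Re (Z \<omega>)) (normal_density 0 (\<sigma> / sqrt 2)) \<and>
     distributed M lborel (\<lambda>\<omega>. Im (Z \<omega>)) (normal_density 0 (\<sigma> / sqrt 2))"

definition circular_gaussian_vector :: "real \<Rightarrow> ('a \<Rightarrow> complex ^ 'n) \<Rightarrow> bool" where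
  "circular_gaussian_vector \<sigma> \<eta> \<longleftrightarrow>
     random_variable borel \<eta> \<and>
     indep_vars (\<lambda>_. borel) (\<lambda>i \<omega>. \<eta> \<omega> $ i) UNIV \<and>
     (\<forall>i. circular_gaussian \<sigma> (\<lambda>\<omega>. \<eta> \<omega> $ i))"

end

end

theory Submission
  imports Defs
begin

text \<open>
  Write \<open>Z\<close> for the norm of the signal, \<open>\<mu>\<close> for the worst-case coherence and \<open>q\<close> for the logarithm of the
  number \<open>p\<close> of columns. As the columns have unit norm, the proxy \<open>f = X\<^sup>H y\<close> satisfies, at each index \<open>i\<close>,
  \<open>f i = \<beta> i + (interference) + (projected noise)\<close>. Here the interference is the sum of
  \<open>z j * \<langle>x i, x (\<pi> j)\<rangle>\<close> over the positions \<open>j\<close> with \<open>\<pi> j \<noteq> i\<close>, and the projected noise is \<open>\<langle>x i, \<eta>\<rangle>\<close>.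
  Suppose that the interference is at most \<open>10 * \<mu> * Z * sqrt (2 * q)\<close> and the projected noise at most
  \<open>2 * \<sigma> * sqrt q\<close> at every index. The threshold \<open>l\<close> is chosen so that the first bound is at most \<open>t * l\<close> and
  the second at most \<open>(1 - t) * l\<close>; hence the proxy is within \<open>l\<close> of the signal. Zero entries are then never
  selected, and entries larger than \<open>2 * l\<close> always are. The condition that defines the number \<open>M\<close> says
  exactly that the \<open>M\<close>-th largest entry exceeds \<open>2 * l\<close> (\<open>LAR_large_imp_mth_largest_large\<close>,
  \<open>thresholding_recovers\<close>).

  The noise bound fails with probability at most \<open>4 / p\<close>. A unit-norm functional of the noise has the
  moment generating function of a circular Gaussian of variance \<open>\<sigma>\<^sup>2\<close>, and a complex number of modulus above
  \<open>sqrt 2 * x\<close> has real part at least \<open>x\<close> after a rotation by one of four quarter turns. So a union bound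
  over \<open>4 * p\<close> one-sided tails of size \<open>1 / p\<^sup>2\<close> suffices (\<open>circular_gaussian_vector_uniform_tail\<close>).

  The interference at index \<open>i\<close> is a weighted sum over a sample without replacement from the cross-correlations
  of column \<open>i\<close>. These are bounded by \<open>\<mu>\<close>, and their mean is tiny by the hypothesis on the average
  coherence. The moment generating function of such a sum is bounded by revealing the sample one position
  at a time (\<open>sum_exp_ext_bijections_le\<close>). The sparsity hypothesis ensures that the sample is at most
  half of the population, so sampling without replacement behaves like independent sampling up to a constant
  factor in the exponent. The resulting failure probability \<open>4 * p * exp (- 8 * q)\<close> is far below \<open>2 / p\<close>
  (\<open>card_cross_correlation_large_le\<close>).

  The two bounds are combined by a union bound over the two exceptional events.
\<close>

section \<open>Quarter turns of the complex plane\<close>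

definition quarter_turns :: "complex set" where
  "quarter_turns = {1, - 1, \<i>, - \<i>}"

lemma quarter_turns_facts:
  "finite quarter_turns" "card quarter_turns \<le> 4" "u \<in> quarter_turns \<Longrightarrow> cmod u = 1"
  by (auto simp: quarter_turns_def card_insert_if)

text \<open>
  Reduces tail bounds for complex quantities to one-sided bounds for four real ones, at the price of
  a factor \<open>sqrt 2\<close> in the deviation.
\<close>

lemma exists_quarter_turn_Re_ge:
  assumes "cmod w > sqrt 2 * x" "x \<ge> 0"
  shows "\<exists>u\<in>quarter_turns. Re (u * w) \<ge> x"
proof (rule ccontr)
  assume "\<not> ?thesis"
  then have "\<bar>Re w\<bar> < x" "\<bar>Im w\<bar> < x" by (auto simp: quarter_turns_def abs_less_iff)
  then have "(Re w)\<^sup>2 \<le> x\<^sup>2" "(Im w)\<^sup>2 \<le> x\<^sup>2" by (simp_all add: abs_le_square_iff[symmetric])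
  then have "(cmod w)\<^sup>2 \<le> (sqrt 2 * x)\<^sup>2" by (simp add: cmod_power2 power_mult_distrib)
  then show False using assms by (simp add: power2_le_iff_abs_le abs_le_square_iff[symmetric])
qed

section \<open>Concentration for sampling without replacement\<close>

definition ext_bijections :: "'i set \<Rightarrow> 'b set \<Rightarrow> ('i \<Rightarrow> 'b) set" where
  "ext_bijections I A = {f \<in> I \<rightarrow>\<^sub>E A. bij_betw f I A}"

lemma finite_ext_bijections:
  assumes "finite I" "finite A"
  shows "finite (ext_bijections I A)"
  unfolding ext_bijections_def using assms by (simp add: finite_PiE)

text \<open>
  Conditioning on the value at one position: what remains is a bijection between sets that are
  smaller by one.
\<close>

lemma sum_ext_bijections_split:
  assumes "finite I" "finite A" "j \<in> I"
  shows "(\<Sum>f\<in>ext_bijections I A. h f) =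
    (\<Sum>l\<in>A. \<Sum>g\<in>ext_bijections (I - {j}) (A - {l}). h (g(j := l)))"
proof -
  have "(\<Sum>l\<in>A. \<Sum>g\<in>ext_bijections (I - {j}) (A - {l}). h (g(j := l))) =
      (\<Sum>(l, g)\<in>(SIGMA l:A. ext_bijections (I - {j}) (A - {l})). h (g(j := l)))"
    using assms by (subst sum.Sigma) (auto intro: finite_ext_bijections)
  also have "\<dots> = (\<Sum>f\<in>ext_bijections I A. h f)"
  proof (rule sum.reindex_bij_witness
      [where i = "\<lambda>f. (f j, f(j := undefined))" and j = "\<lambda>(l, g). g(j := l)"])
    fix x assume "x \<in> (SIGMA l:A. ext_bijections (I - {j}) (A - {l}))"
    then obtain l g where x: "x = (l, g)" "l \<in> A" and g: "g \<in> (I - {j}) \<rightarrow>\<^sub>E (A - {l})"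
      "bij_betw g (I - {j}) (A - {l})"
      by (auto simp: ext_bijections_def)
    have "g j = undefined" using g(1) by (auto simp: PiE_def extensional_def)
    then show "((case x of (l, g) \<Rightarrow> g(j := l)) j, (case x of (l, g) \<Rightarrow> g(j := l))(j := undefined)) = x"
      using x by (auto simp: fun_eq_iff)
    have "bij_betw (g(j := l)) (I - {j}) (A - {l})"
      using g(2) by (subst bij_betw_cong[of _ _ g]) auto
    then have "bij_betw (g(j := l)) ({j} \<union> (I - {j})) ({l} \<union> (A - {l}))"
      by (intro bij_betw_combine) auto
    moreover have "{j} \<union> (I - {j}) = I" "{l} \<union> (A - {l}) = A" using assms x by auto
    ultimately have b: "bij_betw (g(j := l)) I A" by simp
    moreover have "g(j := l) \<in> extensional I"
      using g(1) assms(3) by (auto simp: PiE_def extensional_def)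
    ultimately show "(case x of (l, g) \<Rightarrow> g(j := l)) \<in> ext_bijections I A"
      using x by (auto simp: ext_bijections_def PiE_def bij_betw_def)
    show "h (case x of (l, g) \<Rightarrow> g(j := l)) = (case x of (l, g) \<Rightarrow> h (g(j := l)))"
      by (simp add: x)
  next
    fix f assume "f \<in> ext_bijections I A"
    then have f: "f \<in> I \<rightarrow>\<^sub>E A" "bij_betw f I A" by (auto simp: ext_bijections_def)
    show "(case (f j, f(j := undefined)) of (l, g) \<Rightarrow> g(j := l)) = f" by simp
    have "bij_betw f (I - {j}) (A - {f j})"
      by (rule bij_betw_DiffI) (use f assms in \<open>auto simp: bij_betw_def\<close>)
    then have "bij_betw (f(j := undefined)) (I - {j}) (A - {f j})"
      by (subst bij_betw_cong[of _ _ f]) auto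
    moreover have "f(j := undefined) \<in> extensional (I - {j})"
      using f(1) by (auto simp: PiE_def extensional_def)
    moreover have "f j \<in> A" using f assms by auto
    ultimately show "(f j, f(j := undefined)) \<in> (SIGMA l:A. ext_bijections (I - {j}) (A - {l}))"
      unfolding ext_bijections_def PiE_def by (blast dest: bij_betw_imp_funcset)
  qed
  finally show ?thesis ..
qed

lemma card_ext_bijections:
  fixes I :: "'i set" and A :: "'b set"
  assumes "finite I" "finite A" "card I = card A"
  shows "card (ext_bijections I A) = fact (card A)"
  using assms
proof (induction I arbitrary: A rule: finite_induct)
  case empty
  then have "A = {}" by simp
  moreover have "ext_bijections ({} :: 'i set) ({} :: 'b set) = {\<lambda>x. undefined}"
    by (auto simp: ext_bijections_def bij_betw_def)
  ultimately show ?case by simp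
next
  case (insert j I)
  have "card (ext_bijections (insert j I) A) =
      (\<Sum>l\<in>A. \<Sum>g\<in>ext_bijections (insert j I - {j}) (A - {l}). 1)"
    using sum_ext_bijections_split[of "insert j I" A j "\<lambda>_. 1::nat"] insert by simp
  also have "\<dots> = (\<Sum>l\<in>A. card (ext_bijections I (A - {l})))"
    using insert by simp
  also have "\<dots> = (\<Sum>l\<in>A. fact (card A - 1))"
    using insert by (intro sum.cong refl) (subst insert.IH, auto)
  also have "\<dots> = card A * fact (card A - 1)"
    by simp
  also have "\<dots> = fact (card A)"
    using insert by (metis One_nat_def card.insert diff_Suc_1 fact_Suc of_nat_id)
  finally show ?case .
qed

text \<open>
  Hoeffding's lemma for the uniform distribution on a finite set, multiplied out so that it can be
  used inside sums over bijections.
\<close>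

lemma sum_exp_le_if_sum_zero:
  fixes d :: "'b \<Rightarrow> real"
  assumes A: "finite A" "A \<noteq> {}" and d: "\<And>l. l \<in> A \<Longrightarrow> d l \<in> {x..y}" and "(\<Sum>l\<in>A. d l) = 0"
  shows "(\<Sum>l\<in>A. exp (d l)) \<le> real (card A) * exp ((y - x)\<^sup>2 / 8)"
proof -
  define P where "P = uniform_count_measure A"
  have sets_P [measurable_cong]: "sets P = sets (count_space A)" and space_P: "space P = A"
    by (simp_all add: P_def sets_uniform_count_measure_count_space space_uniform_count_measure)
  interpret prob_space P
    unfolding P_def using A by (rule prob_space_uniform_count_measure)
  interpret interval_bounded_random_variable P d x y
    by unfold_locales (use d in \<open>auto simp: space_P intro!: AE_I2\<close>)
  have "expectation d = 0"
    unfolding P_def using assms by (simp add: integral_uniform_count_measure)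
  then have "(\<integral>\<^sup>+l. exp (1 * d l) \<partial>P) \<le> ennreal (exp (1\<^sup>2 * (y - x)\<^sup>2 / 8))"
    by (intro Hoeffdings_lemma_nn_integral_0) auto
  moreover have "(\<integral>\<^sup>+l. exp (1 * d l) \<partial>P) = ennreal (expectation (\<lambda>l. exp (d l)))"
  proof (subst nn_integral_eq_integral)
    show "integrable P (\<lambda>l. exp (1 * d l))"
      by (rule integrable_const_bound[of _ "exp y"]) (use d in \<open>auto simp: space_P intro!: AE_I2\<close>)
  qed auto
  ultimately have "expectation (\<lambda>l. exp (d l)) \<le> exp ((y - x)\<^sup>2 / 8)"
    by (simp add: ennreal_le_iff)
  then have "(\<Sum>l\<in>A. exp (d l)) / card A \<le> exp ((y - x)\<^sup>2 / 8)"
    unfolding P_def using A by (simp add: integral_uniform_count_measure)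
  then show ?thesis
    using A by (simp add: field_simps card_gt_0_iff)
qed

lemma norm_diff_sq_le: "(cmod (x - y))\<^sup>2 \<le> 2 * (cmod x)\<^sup>2 + 2 * (cmod y)\<^sup>2"
proof -
  have "(cmod (x - y))\<^sup>2 \<le> (cmod x + cmod y)\<^sup>2"
    by (intro power_mono norm_triangle_ineq4) auto
  also have "\<dots> \<le> 2 * (cmod x)\<^sup>2 + 2 * (cmod y)\<^sup>2"
    using sum_squares_bound[of "cmod x" "cmod y"] by (simp add: power2_sum)
  finally show ?thesis .
qed

text \<open>
  The moment generating function of a linear statistic of a sample without replacement. The
  induction reveals one position \<open>j\<close> at a time. If \<open>a l\<close> is drawn there, the mean of the remaining
  population moves by \<open>-(a l - \<alpha>) / (m - 1)\<close>, where \<open>m\<close> is the population size and \<open>\<alpha>\<close> its mean, so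
  relative to the total expectation the draw contributes \<open>(z j - S / (m - 1)) * (a l - \<alpha>)\<close> with \<open>S\<close>
  the sum of the weights still to come. This has mean zero and range at most
  \<open>2 * B * cmod (z j - S / (m - 1))\<close>, and Hoeffding's lemma applies: the usual martingale argument,
  carried out by hand. The parameter \<open>N\<close> counts positions that are never revealed; it keeps \<open>m - 1\<close>
  large, so that the feedback term \<open>S / (m - 1)\<close> is at most \<open>T / N\<close>.
\<close>

lemma sum_exp_ext_bijections_le:
  fixes z :: "'i \<Rightarrow> complex" and a :: "'b \<Rightarrow> complex"
  assumes "finite K" "K \<subseteq> I" "finite I" "finite A" "card I = card A"
    and "card K + N \<le> card A" "N > 0"
    and "\<And>l. l \<in> A \<Longrightarrow> cmod (a l) \<le> B" and "(\<Sum>j\<in>K. cmod (z j)) \<le> T"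
  shows "(\<Sum>f\<in>ext_bijections I A. exp (\<Sum>j\<in>K. Re (z j * a (f j)))) \<le> fact (card A) *
    exp (Re ((\<Sum>j\<in>K. z j) * ((\<Sum>l\<in>A. a l) / card A)) +
      B\<^sup>2 * ((\<Sum>j\<in>K. (cmod (z j))\<^sup>2) + real (card K) * (T / N)\<^sup>2))"
  using assms
proof (induction K arbitrary: I A rule: finite_induct)
  case empty
  then show ?case by (simp add: card_ext_bijections)
next
  case (insert j K)
  define m where "m = real (card A)"
  define S where "S = (\<Sum>i\<in>K. z i)"
  define \<alpha> where "\<alpha> = (\<Sum>l\<in>A. a l) / m"
  define c where "c = z j - S / (m - 1)"
  define R where "R = B\<^sup>2 * ((\<Sum>i\<in>K. (cmod (z i))\<^sup>2) + real (card K) * (T / N)\<^sup>2)"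
  have cardA: "card A \<ge> 2" "card K + 1 + N \<le> card A" using insert.prems insert.hyps by auto
  then have m: "m \<ge> 2" "m - 1 \<ge> N" by (auto simp: m_def)
  have A: "finite A" "A \<noteq> {}" using insert.prems cardA by auto
  have B: "B \<ge> 0" using insert.prems(7) A by (meson all_not_in_conv norm_ge_zero order_trans)
  have S_T: "(\<Sum>i\<in>K. cmod (z i)) \<le> T" "cmod S \<le> T"
  proof -
    show "(\<Sum>i\<in>K. cmod (z i)) \<le> T" using insert by simp (smt (verit) norm_ge_zero)
    then show "cmod S \<le> T" unfolding S_def using norm_sum[of z K] by linarith
  qed
  have inner: "(\<Sum>g\<in>ext_bijections (I - {j}) (A - {l}). exp (\<Sum>i\<in>insert j K. Re (z i * a ((g(j := l)) i))))
      \<le> fact (card A - 1) * exp (Re ((z j + S) * \<alpha>) + R) * exp (Re (c * (a l - \<alpha>)))"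
    if l: "l \<in> A" for l
  proof -
    have "(\<Sum>i\<in>insert j K. Re (z i * a ((g(j := l)) i))) = Re (z j * a l) + (\<Sum>i\<in>K. Re (z i * a (g i)))" for g
    proof -
      have "(\<Sum>i\<in>K. Re (z i * a ((g(j := l)) i))) = (\<Sum>i\<in>K. Re (z i * a (g i)))"
        using insert.hyps by (intro sum.cong) auto
      then show ?thesis using insert.hyps by simp
    qed
    then have "(\<Sum>g\<in>ext_bijections (I - {j}) (A - {l}). exp (\<Sum>i\<in>insert j K. Re (z i * a ((g(j := l)) i))))
      = exp (Re (z j * a l)) * (\<Sum>g\<in>ext_bijections (I - {j}) (A - {l}). exp (\<Sum>i\<in>K. Re (z i * a (g i))))"
      by (simp only: exp_add sum_distrib_left)
    also have "\<dots> \<le> exp (Re (z j * a l)) * (fact (card (A - {l})) *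
        exp (Re (S * ((\<Sum>l\<in>A - {l}. a l) / card (A - {l}))) + R))"
      unfolding S_def R_def using insert.prems insert.hyps l S_T
      by (intro mult_left_mono insert.IH) auto
    also have "\<dots> = fact (card A - 1) *
        exp (Re (z j * a l) + Re (S * ((\<Sum>l\<in>A - {l}. a l) / card (A - {l}))) + R)"
      using l A by (simp add: exp_add)
    also have "Re (z j * a l) + Re (S * ((\<Sum>l\<in>A - {l}. a l) / card (A - {l}))) =
        Re ((z j + S) * \<alpha>) + Re (c * (a l - \<alpha>))"
    proof -
      have "(\<Sum>l\<in>A - {l}. a l) = m * \<alpha> - a l"
        using l A m by (simp add: sum_diff1 \<alpha>_def)
      moreover have "of_nat (card (A - {l})) = complex_of_real (m - 1)"
        using l A m by (simp add: m_def of_nat_diff)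
      moreover have "z j * a l + S * ((m * \<alpha> - a l) / (m - 1)) = (z j + S) * \<alpha> + c * (a l - \<alpha>)"
      proof -
        define d where "d = complex_of_real (m - 1)"
        define r where "r = S / d"
        have d: "d \<noteq> 0" "complex_of_real m = d + 1" using m by (simp_all add: d_def)
        have c: "c = z j - r" by (simp add: c_def r_def d_def)
        have "S = r * d" using d(1) by (simp add: r_def)
        then have "z j * a l + S * (((d + 1) * \<alpha> - a l) / d) = z j * a l + r * ((d + 1) * \<alpha> - a l)"
          using d(1) by simp
        also have "\<dots> = (z j + r * d) * \<alpha> + (z j - r) * (a l - \<alpha>)"
          by (simp add: algebra_simps)
        also have "\<dots> = (z j + S) * \<alpha> + c * (a l - \<alpha>)"
          by (simp only: flip: \<open>S = r * d\<close> c)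
        finally show ?thesis
          unfolding d(2) d_def[symmetric] .
      qed
      ultimately have "z j * a l + S * ((\<Sum>l\<in>A - {l}. a l) / card (A - {l})) = (z j + S) * \<alpha> + c * (a l - \<alpha>)"
        by (simp only:)
      then show ?thesis by (metis plus_complex.simps(1))
    qed
    finally show ?thesis by (simp add: exp_add mult_ac)
  qed
  \<comment> \<open>Only the range of the real part matters for Hoeffding; it is centred at the real part of - c * alpha.\<close>
  have "(\<Sum>l\<in>A. exp (Re (c * (a l - \<alpha>)))) \<le> real (card A) *
      exp (((Re (- c * \<alpha>) + cmod c * B) - (Re (- c * \<alpha>) - cmod c * B))\<^sup>2 / 8)"
  proof (rule sum_exp_le_if_sum_zero)
    show "Re (c * (a l - \<alpha>)) \<in> {Re (- c * \<alpha>) - cmod c * B..Re (- c * \<alpha>) + cmod c * B}"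
      if "l \<in> A" for l
    proof -
      have "\<bar>Re (c * a l)\<bar> \<le> cmod c * cmod (a l)" using abs_Re_le_cmod[of "c * a l"] by (simp add: norm_mult)
      also have "\<dots> \<le> cmod c * B" using insert.prems that by (intro mult_left_mono) auto
      finally show ?thesis by (auto simp: algebra_simps)
    qed
    have "(\<Sum>l\<in>A. Re (c * (a l - \<alpha>))) = Re (\<Sum>l\<in>A. c * (a l - \<alpha>))"
      by (rule Re_sum[symmetric])
    also have "(\<Sum>l\<in>A. c * (a l - \<alpha>)) = c * ((\<Sum>l\<in>A. a l) - m * \<alpha>)"
      by (simp add: sum_subtractf m_def flip: sum_distrib_left)
    also have "Re \<dots> = 0" using m by (simp add: \<alpha>_def)
    finally show "(\<Sum>l\<in>A. Re (c * (a l - \<alpha>))) = 0" .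
  qed (use A in auto)
  also have "((Re (- c * \<alpha>) + cmod c * B) - (Re (- c * \<alpha>) - cmod c * B))\<^sup>2 / 8 = B\<^sup>2 * ((cmod c)\<^sup>2 / 2)"
    by (simp add: power2_eq_square)
  finally have hoeffding: "(\<Sum>l\<in>A. exp (Re (c * (a l - \<alpha>)))) \<le> real (card A) * exp (B\<^sup>2 * ((cmod c)\<^sup>2 / 2))" .
  have "B\<^sup>2 * ((cmod c)\<^sup>2 / 2) \<le> B\<^sup>2 * ((cmod (z j))\<^sup>2 + (T / N)\<^sup>2)"
  proof (rule mult_left_mono)
    have "cmod (S / (m - 1)) \<le> T / N"
    proof -
      have "cmod (S / (m - 1)) = cmod S / (m - 1)"
        using m by (simp only: norm_divide norm_of_real)
      then show ?thesis
        using m S_T order_trans[OF norm_ge_zero S_T(2)] insert.prems by (auto intro!: frac_le)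
    qed
    then have "(cmod (S / (m - 1)))\<^sup>2 \<le> (T / N)\<^sup>2" by (intro power_mono) auto
    then show "(cmod c)\<^sup>2 / 2 \<le> (cmod (z j))\<^sup>2 + (T / N)\<^sup>2"
      unfolding c_def using norm_diff_sq_le[of "z j" "S / (m - 1)"] by linarith
  qed auto
  then have outer: "(\<Sum>l\<in>A. exp (Re (c * (a l - \<alpha>)))) \<le>
      real (card A) * exp (B\<^sup>2 * ((cmod (z j))\<^sup>2 + (T / N)\<^sup>2))"
    by (intro order_trans[OF hoeffding] mult_left_mono) auto
  have "(\<Sum>f\<in>ext_bijections I A. exp (\<Sum>i\<in>insert j K. Re (z i * a (f i)))) =
      (\<Sum>l\<in>A. \<Sum>g\<in>ext_bijections (I - {j}) (A - {l}).
        exp (\<Sum>i\<in>insert j K. Re (z i * a ((g(j := l)) i))))"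
    using insert.prems by (intro sum_ext_bijections_split) auto
  also have "\<dots> \<le> (\<Sum>l\<in>A. fact (card A - 1) * exp (Re ((z j + S) * \<alpha>) + R) * exp (Re (c * (a l - \<alpha>))))"
    by (intro sum_mono inner)
  also have "\<dots> = fact (card A - 1) * exp (Re ((z j + S) * \<alpha>) + R) * (\<Sum>l\<in>A. exp (Re (c * (a l - \<alpha>))))"
    by (simp add: sum_distrib_left)
  also have "\<dots> \<le> fact (card A - 1) * exp (Re ((z j + S) * \<alpha>) + R) *
      (real (card A) * exp (B\<^sup>2 * ((cmod (z j))\<^sup>2 + (T / N)\<^sup>2)))"
    by (intro mult_left_mono outer) auto
  also have "\<dots> = (real (card A) * fact (card A - 1)) *
      exp (Re ((z j + S) * \<alpha>) + (R + B\<^sup>2 * ((cmod (z j))\<^sup>2 + (T / N)\<^sup>2)))"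
    by (simp add: exp_add mult_ac)
  also have "real (card A) * fact (card A - 1) = fact (card A)"
    using cardA by (simp add: fact_reduce)
  also have "R + B\<^sup>2 * ((cmod (z j))\<^sup>2 + (T / N)\<^sup>2) =
      B\<^sup>2 * ((\<Sum>i\<in>insert j K. (cmod (z i))\<^sup>2) + real (card (insert j K)) * (T / N)\<^sup>2)"
    using insert.hyps by (simp add: R_def algebra_simps)
  also have "z j + S = (\<Sum>i\<in>insert j K. z i)" using insert.hyps by (simp add: S_def)
  finally show ?case by (simp add: \<alpha>_def m_def)
qed

text \<open>
  Chernoff's bound with parameter \<open>s = L / (B * Z)\<close>, counting bijections instead of measuring
  probabilities. With this \<open>s\<close>, the mean contributes at most \<open>L\<close> to the exponent because the population
  mean is at most \<open>B / sqrt k\<close> and the weights satisfy \<open>\<Sum> cmod (z j) \<le> sqrt k * Z\<close> by Cauchy-Schwarz.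
  The fluctuations contribute at most \<open>2 * L\<^sup>2\<close>, the sample being at most half of the population. The
  exponent \<open>L + 2 * L\<^sup>2 - 7 * L\<^sup>2\<close> is then at most \<open>- 4 * L\<^sup>2\<close>.
\<close>

lemma card_Re_sum_ge_le:
  fixes z :: "'i \<Rightarrow> complex" and a :: "'b \<Rightarrow> complex" and B L Z :: real
  assumes fin: "finite I" "finite A" "card I = card A" and K: "K \<subseteq> I" "K \<noteq> {}" "2 * card K \<le> card A"
    and a: "\<And>l. l \<in> A \<Longrightarrow> cmod (a l) \<le> B" and "B > 0"
    and mean: "cmod (\<Sum>l\<in>A. a l) \<le> real (card A) * (B / sqrt (real (card K)))"
    and Z: "Z = sqrt (\<Sum>j\<in>K. (cmod (z j))\<^sup>2)" "Z > 0" and L: "L \<ge> 1"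
  shows "real (card {f \<in> ext_bijections I A. Re (\<Sum>j\<in>K. z j * a (f j)) \<ge> 7 * B * Z * L})
    \<le> fact (card A) * exp (- 4 * L\<^sup>2)"
proof -
  define k where "k = card K"
  define N where "N = card A - k"
  define s where "s = L / (B * Z)"
  define w where "w = (\<lambda>j. of_real s * z j)"
  define T where "T = s * (sqrt k * Z)"
  let ?F = "ext_bijections I A"
  let ?V = "\<lambda>f. Re (\<Sum>j\<in>K. z j * a (f j))"
  have finK: "finite K" using K fin finite_subset by blast
  then have k: "k > 0" "2 * k \<le> card A" using K by (auto simp: k_def card_gt_0_iff)
  have N: "N > 0" "real N \<ge> real k" "k + N = card A" using k by (auto simp: N_def)
  have s: "s > 0" using \<open>B > 0\<close> Z L by (simp add: s_def)
  have Z2: "Z\<^sup>2 = (\<Sum>j\<in>K. (cmod (z j))\<^sup>2)" using Z by (simp add: sum_nonneg)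
  have T: "(\<Sum>j\<in>K. cmod (w j)) \<le> T"
  proof -
    have "(\<Sum>j\<in>K. \<bar>cmod (z j)\<bar> * \<bar>1\<bar>) \<le> L2_set (\<lambda>j. cmod (z j)) K * L2_set (\<lambda>_. 1) K"
      by (rule L2_set_mult_ineq)
    then have "(\<Sum>j\<in>K. cmod (z j)) \<le> sqrt k * Z"
      by (simp add: L2_set_def Z k_def mult.commute)
    then show ?thesis
      using s by (simp add: w_def T_def norm_mult flip: sum_distrib_left)
  qed
  have mean_term: "Re ((\<Sum>j\<in>K. w j) * ((\<Sum>l\<in>A. a l) / card A)) \<le> L"
  proof -
    have "Re ((\<Sum>j\<in>K. w j) * ((\<Sum>l\<in>A. a l) / card A)) \<le> cmod (\<Sum>j\<in>K. w j) * (cmod (\<Sum>l\<in>A. a l) / card A)"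
      by (rule order_trans[OF complex_Re_le_cmod]) (simp add: norm_mult norm_divide)
    also have "\<dots> \<le> T * (B / sqrt k)"
    proof (rule mult_mono)
      show "cmod (\<Sum>j\<in>K. w j) \<le> T" using norm_sum[of w K] T by linarith
      show "cmod (\<Sum>l\<in>A. a l) / card A \<le> B / sqrt k"
        using mean k by (simp add: field_simps k_def)
    qed (use s Z in \<open>auto simp: T_def\<close>)
    also have "\<dots> = L" using k Z \<open>B > 0\<close> by (simp add: T_def s_def)
    finally show ?thesis .
  qed
  have var_term: "B\<^sup>2 * ((\<Sum>j\<in>K. (cmod (w j))\<^sup>2) + real (card K) * (T / N)\<^sup>2) \<le> 2 * L\<^sup>2"
  proof -
    have "(\<Sum>j\<in>K. (cmod (w j))\<^sup>2) = s\<^sup>2 * Z\<^sup>2"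
      by (simp add: w_def norm_mult power_mult_distrib Z2 flip: sum_distrib_left)
    moreover have "real (card K) * (T / N)\<^sup>2 \<le> s\<^sup>2 * Z\<^sup>2"
    proof -
      have "real (card K) * (T / N)\<^sup>2 = (real k / real N)\<^sup>2 * (s\<^sup>2 * Z\<^sup>2)"
        by (simp add: T_def k_def power_mult_distrib power_divide power2_eq_square)
      also have "\<dots> \<le> 1 * (s\<^sup>2 * Z\<^sup>2)"
        using N by (intro mult_right_mono) (auto simp: power_le_one)
      finally show ?thesis by simp
    qed
    ultimately have "B\<^sup>2 * ((\<Sum>j\<in>K. (cmod (w j))\<^sup>2) + real (card K) * (T / N)\<^sup>2) \<le> B\<^sup>2 * (2 * (s\<^sup>2 * Z\<^sup>2))"
      by (intro mult_left_mono) (linarith, simp)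
    also have "\<dots> = 2 * L\<^sup>2"
      using \<open>B > 0\<close> Z by (simp add: s_def power_divide power_mult_distrib)
    finally show ?thesis .
  qed
  have "real (card {f \<in> ?F. ?V f \<ge> 7 * B * Z * L}) * exp (7 * L\<^sup>2) =
      (\<Sum>f \<in> {f \<in> ?F. ?V f \<ge> 7 * B * Z * L}. exp (s * (7 * B * Z * L)))"
    using \<open>B > 0\<close> Z by (simp add: s_def power2_eq_square)
  also have "\<dots> \<le> (\<Sum>f \<in> {f \<in> ?F. ?V f \<ge> 7 * B * Z * L}. exp (s * ?V f))"
    using s by (intro sum_mono) auto
  also have "\<dots> \<le> (\<Sum>f \<in> ?F. exp (s * ?V f))"
    using fin by (intro sum_mono2) (auto simp: finite_ext_bijections)
  also have "\<dots> = (\<Sum>f \<in> ?F. exp (\<Sum>j\<in>K. Re (w j * a (f j))))"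
    by (simp add: w_def sum_distrib_left right_diff_distrib mult_ac)
  also have "\<dots> \<le> fact (card A) * exp (Re ((\<Sum>j\<in>K. w j) * ((\<Sum>l\<in>A. a l) / card A)) +
      B\<^sup>2 * ((\<Sum>j\<in>K. (cmod (w j))\<^sup>2) + real (card K) * (T / N)\<^sup>2))"
    using fin K finK N a T by (intro sum_exp_ext_bijections_le) (auto simp: k_def)
  also have "\<dots> \<le> fact (card A) * exp (L + 2 * L\<^sup>2)"
    using mean_term var_term by (intro mult_left_mono) auto
  also have "\<dots> \<le> fact (card A) * exp (- 4 * L\<^sup>2 + 7 * L\<^sup>2)"
    using L by (intro mult_left_mono) (auto simp: power2_eq_square)
  also have "\<dots> = fact (card A) * exp (- 4 * L\<^sup>2) * exp (7 * L\<^sup>2)"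
    by (subst exp_add) simp
  finally show ?thesis by (simp only: mult_le_cancel_right_pos exp_gt_zero)
qed

section \<open>Interference under coherence\<close>

lemma index_perms_eq_ext_bijections:
  "(index_perms :: (nat \<Rightarrow> 'p::finite) set) = ext_bijections {1..CARD('p)} UNIV"
  by (simp add: index_perms_def ext_bijections_def)

lemma cmod_hinner_columns_le:
  "i \<noteq> j \<Longrightarrow> cmod (hinner (column i X) (column j X)) \<le> worst_case_coherence X"
  unfolding worst_case_coherence_def
proof (rule Max_ge)
  have "{cmod (hinner (column i X) (column j X)) | i j. i \<noteq> j} \<subseteq>
      (\<lambda>(i, j). cmod (hinner (column i X) (column j X))) ` UNIV" by auto
  then show "finite {cmod (hinner (column i X) (column j X)) | i j. i \<noteq> j}"
    by (rule finite_subset) simp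
qed auto

lemma cmod_sum_hinner_columns_le:
  fixes X :: "complex ^ 'p ^ 'n"
  assumes "CARD('p) > 1"
  shows "cmod (\<Sum>j\<in>UNIV - {i}. hinner (column i X) (column j X)) \<le>
    (real CARD('p) - 1) * average_coherence X"
proof -
  have "cmod (\<Sum>j\<in>UNIV - {i}. hinner (column i X) (column j X)) \<le>
      (MAX i. cmod (\<Sum>j\<in>UNIV - {i}. hinner (column i X) (column j X)))"
    by (intro Max_ge) auto
  then show ?thesis using assms by (simp add: average_coherence_def)
qed

text \<open>
  The diagonal entries of the Gram matrix are replaced by zero. The interference in the proxy at
  column \<open>i\<close> is then the same sum over all signal positions whether or not \<open>i\<close> lies in the support, and
  both cases are covered by one tail bound for a uniformly random permutation.
\<close>

definition cross_correlation :: "complex ^ 'p ^ 'n \<Rightarrow> 'p \<Rightarrow> 'p \<Rightarrow> complex" where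
  "cross_correlation X i l = (if l = i then 0 else hinner (column i X) (column l X))"

text \<open>
  A random support is almost orthogonal to every column. Row \<open>i\<close> of the cross-correlations is a
  population bounded by the worst-case coherence, whose mean is controlled by the average coherence.
  A union bound over the columns and the quarter turns leads back to real parts, and the constant
  \<open>10\<close> leaves room for \<open>7 * sqrt 2\<close>.
\<close>

lemma card_cross_correlation_large_le:
  fixes X :: "complex ^ 'p ^ 'n" and z :: "nat \<Rightarrow> complex" and L Z :: real
  assumes coh: "average_coherence X \<le> worst_case_coherence X / sqrt (real CARD('n))"
    and k: "0 < k" "k \<le> CARD('n)" "2 * k \<le> CARD('p)"
    and Z: "Z = sqrt (\<Sum>j\<in>{1..k}. (cmod (z j))\<^sup>2)" "Z > 0" and L: "L \<ge> 1"
  shows "real (card {f \<in> index_perms.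
      \<exists>i. cmod (\<Sum>j\<in>{1..k}. z j * cross_correlation X i (f j)) > 10 * worst_case_coherence X * Z * L})
    \<le> 4 * real CARD('p) * exp (- 4 * L\<^sup>2) * fact CARD('p)"
proof (cases "worst_case_coherence X > 0")
  case False
  \<comment> \<open>If the columns are orthogonal, the interference vanishes and the Chernoff parameter would be a division by zero.\<close>
  have "cross_correlation X i l = 0" for i l
    using cmod_hinner_columns_le[of i l X] False
    by (auto simp: cross_correlation_def) (smt (verit) norm_ge_zero norm_le_zero_iff)
  moreover have "worst_case_coherence X \<ge> 0"
  proof -
    obtain i j :: 'p where "i \<noteq> j"
      using k card_le_Suc0_iff_eq[of "UNIV :: 'p set"] by force
    then show ?thesis using cmod_hinner_columns_le[of i j X] norm_ge_zero order_trans by blast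
  qed
  ultimately have "{f \<in> index_perms.
      \<exists>i. cmod (\<Sum>j\<in>{1..k}. z j * cross_correlation X i (f j)) > 10 * worst_case_coherence X * Z * L} = {}"
    using False by auto
  then show ?thesis by (simp only: card.empty) simp
next
  case True
  let ?\<mu> = "worst_case_coherence X"
  define A where "A = (\<lambda>i u. {f \<in> index_perms.
      Re (\<Sum>j\<in>{1..k}. (u * z j) * cross_correlation X i (f j)) \<ge> 7 * ?\<mu> * Z * L})"
  note perms = index_perms_eq_ext_bijections[where ?'p = 'p]
  have fin: "finite (index_perms :: (nat \<Rightarrow> 'p) set)"
    unfolding perms by (rule finite_ext_bijections) auto
  have cardA: "real (card (A i u)) \<le> fact CARD('p) * exp (- 4 * L\<^sup>2)" if u: "u \<in> quarter_turns" for i u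
    unfolding A_def perms
  proof (rule card_Re_sum_ge_le)
    show "cmod (cross_correlation X i l) \<le> ?\<mu>" for l
      using True cmod_hinner_columns_le[of i l X] by (auto simp: cross_correlation_def)
    have "(\<Sum>l\<in>UNIV. cross_correlation X i l) = (\<Sum>l\<in>UNIV - {i}. hinner (column i X) (column l X))"
      by (intro sum.mono_neutral_cong_right) (auto simp: cross_correlation_def)
    then have "cmod (\<Sum>l\<in>UNIV. cross_correlation X i l) \<le> (real CARD('p) - 1) * average_coherence X"
      using cmod_sum_hinner_columns_le[of i X] k by simp
    also have "\<dots> \<le> (real CARD('p) - 1) * (?\<mu> / sqrt (real CARD('n)))"
      using coh k by (intro mult_left_mono) auto
    also have "\<dots> \<le> real CARD('p) * (?\<mu> / sqrt (real (card {1..k})))"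
      using True k by (intro mult_mono divide_left_mono) auto
    finally show "cmod (\<Sum>l\<in>UNIV. cross_correlation X i l) \<le> real (card (UNIV :: 'p set)) * (?\<mu> / sqrt (real (card {1..k})))" .
    show "Z = sqrt (\<Sum>j\<in>{1..k}. (cmod (u * z j))\<^sup>2)"
      using Z quarter_turns_facts(3)[OF u] by (simp add: norm_mult)
  qed (use k Z L True in auto)
  have "{f \<in> index_perms. \<exists>i. cmod (\<Sum>j\<in>{1..k}. z j * cross_correlation X i (f j)) > 10 * ?\<mu> * Z * L}
      \<subseteq> (\<Union>i. \<Union>u\<in>quarter_turns. A i u)" (is "?lhs \<subseteq> ?rhs")
  proof safe
    fix f i assume f: "f \<in> index_perms"
      and big: "cmod (\<Sum>j\<in>{1..k}. z j * cross_correlation X i (f j)) > 10 * ?\<mu> * Z * L"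
    have "sqrt 2 * 7 \<le> 10"
      by (rule power2_le_imp_le) (auto simp: power_mult_distrib)
    then have "sqrt 2 * 7 * (?\<mu> * Z * L) \<le> 10 * (?\<mu> * Z * L)"
      using True Z L by (intro mult_right_mono) auto
    with big have large: "sqrt 2 * (7 * ?\<mu> * Z * L) < cmod (\<Sum>j\<in>{1..k}. z j * cross_correlation X i (f j))"
      by (simp add: mult_ac)
    have "0 \<le> 7 * ?\<mu> * Z * L" using True Z L by simp
    from exists_quarter_turn_Re_ge[OF large this] obtain u where "u \<in> quarter_turns"
      "Re (u * (\<Sum>j\<in>{1..k}. z j * cross_correlation X i (f j))) \<ge> 7 * ?\<mu> * Z * L"
      by blast
    then show "f \<in> ?rhs" using f by (auto simp: A_def sum_distrib_left mult.assoc)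
  qed
  moreover have "finite ?rhs" by (auto simp: quarter_turns_facts A_def fin)
  ultimately have "real (card ?lhs) \<le> real (card ?rhs)" by (intro of_nat_mono card_mono)
  also have "\<dots> \<le> (\<Sum>i\<in>UNIV. \<Sum>u\<in>quarter_turns. real (card (A i u)))"
  proof -
    have "card ?rhs \<le> (\<Sum>i\<in>UNIV. card (\<Union>u\<in>quarter_turns. A i u))"
      by (rule card_UN_le) simp
    also have "\<dots> \<le> (\<Sum>i\<in>UNIV. \<Sum>u\<in>quarter_turns. card (A i u))"
      by (intro sum_mono card_UN_le) (simp add: quarter_turns_facts)
    finally show ?thesis by (simp only: of_nat_sum of_nat_le_iff flip: of_nat_sum)
  qed
  also have "\<dots> \<le> (\<Sum>i\<in>(UNIV :: 'p set). \<Sum>u\<in>quarter_turns. fact CARD('p) * exp (- 4 * L\<^sup>2))"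
    by (intro sum_mono cardA)
  also have "\<dots> = real CARD('p) * (real (card quarter_turns) * (fact CARD('p) * exp (- 4 * L\<^sup>2)))"
    by simp
  also have "\<dots> \<le> real CARD('p) * (4 * (fact CARD('p) * exp (- 4 * L\<^sup>2)))"
    using quarter_turns_facts(2) by (intro mult_left_mono mult_right_mono) auto
  finally show ?thesis by (simp add: mult_ac)
qed

section \<open>Linear functionals of circular Gaussian noise\<close>

lemma Re_of_real_mult: "Re (of_real r * w) = r * Re w"
  by simp

text \<open>
  Completing the square turns the integrand into a constant times a shifted normal density.
\<close>

lemma nn_integral_normal_density_exp:
  assumes "\<tau> > 0"
  shows "(\<integral>\<^sup>+x. ennreal (normal_density 0 \<tau> x) * ennreal (exp (s * x)) \<partial>lborel) = ennreal (exp (s\<^sup>2 * \<tau>\<^sup>2 / 2))"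
proof -
  have "normal_density 0 \<tau> x * exp (s * x) = exp (s\<^sup>2 * \<tau>\<^sup>2 / 2) * normal_density (s * \<tau>\<^sup>2) \<tau> x" for x
  proof -
    have "- x\<^sup>2 / (2 * \<tau>\<^sup>2) + s * x = s\<^sup>2 * \<tau>\<^sup>2 / 2 + - (x - s * \<tau>\<^sup>2)\<^sup>2 / (2 * \<tau>\<^sup>2)"
      using assms by (simp add: field_simps power2_eq_square)
    then have "exp (- x\<^sup>2 / (2 * \<tau>\<^sup>2)) * exp (s * x) =
        exp (s\<^sup>2 * \<tau>\<^sup>2 / 2) * exp (- (x - s * \<tau>\<^sup>2)\<^sup>2 / (2 * \<tau>\<^sup>2))"
      by (simp only: flip: exp_add)
    then show ?thesis by (simp add: normal_density_def)
  qed
  then have "(\<integral>\<^sup>+x. ennreal (normal_density 0 \<tau> x) * ennreal (exp (s * x)) \<partial>lborel) =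
      (\<integral>\<^sup>+x. ennreal (exp (s\<^sup>2 * \<tau>\<^sup>2 / 2)) * ennreal (normal_density (s * \<tau>\<^sup>2) \<tau> x) \<partial>lborel)"
    by (simp flip: ennreal_mult)
  also have "\<dots> = ennreal (exp (s\<^sup>2 * \<tau>\<^sup>2 / 2)) * (\<integral>\<^sup>+x. ennreal (normal_density (s * \<tau>\<^sup>2) \<tau> x) \<partial>lborel)"
    by (rule nn_integral_cmult) simp
  also have "(\<integral>\<^sup>+x. ennreal (normal_density (s * \<tau>\<^sup>2) \<tau> x) \<partial>lborel) = 1"
    using assms by (subst nn_integral_eq_integral) auto
  finally show ?thesis by simp
qed

context prob_space
begin

lemma normal_mgf:
  assumes "distributed M lborel V (normal_density 0 \<tau>)" "\<tau> > 0"
  shows "(\<integral>\<^sup>+\<omega>. ennreal (exp (s * V \<omega>)) \<partial>M) = ennreal (exp (s\<^sup>2 * \<tau>\<^sup>2 / 2))"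
  using distributed_nn_integral[OF assms(1), of "\<lambda>x. ennreal (exp (s * x))"]
    nn_integral_normal_density_exp[OF assms(2), of s] by simp

lemma circular_gaussian_measurable:
  assumes "circular_gaussian \<sigma> Z"
  shows "(\<lambda>\<omega>. Re (Z \<omega>)) \<in> borel_measurable M" "(\<lambda>\<omega>. Im (Z \<omega>)) \<in> borel_measurable M"
  using assms unfolding circular_gaussian_def by (auto dest: indep_var_rv1 indep_var_rv2)

text \<open>
  The exponent depends on \<open>c\<close> only through its modulus, which is the circular symmetry of the
  distribution. It is used below for rotated coefficients.
\<close>

lemma circular_gaussian_mgf:
  assumes Z: "circular_gaussian \<sigma> Z" and "\<sigma> > 0"
  shows "(\<integral>\<^sup>+\<omega>. ennreal (exp (Re (c * Z \<omega>))) \<partial>M) = ennreal (exp (\<sigma>\<^sup>2 / 4 * (cmod c)\<^sup>2))"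
proof -
  note [measurable] = circular_gaussian_measurable[OF Z]
  let ?U = "\<lambda>\<omega>. ennreal (exp (Re c * Re (Z \<omega>)))" and ?V = "\<lambda>\<omega>. ennreal (exp (- Im c * Im (Z \<omega>)))"
  have "indep_var borel ((\<lambda>x. ennreal (exp (Re c * x))) \<circ> (\<lambda>\<omega>. Re (Z \<omega>)))
      borel ((\<lambda>x. ennreal (exp (- Im c * x))) \<circ> (\<lambda>\<omega>. Im (Z \<omega>)))"
    by (rule indep_var_compose) (use Z in \<open>auto simp: circular_gaussian_def\<close>)
  then have "indep_vars (case_bool borel borel) (case_bool ?U ?V) UNIV"
    unfolding indep_var_def comp_def .
  moreover have "case_bool borel borel = (\<lambda>_. borel :: ennreal measure)"
    by (auto split: bool.split)
  ultimately have ind: "indep_vars (\<lambda>_. borel) (case_bool ?U ?V) UNIV"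
    by (simp only:)
  have "(\<integral>\<^sup>+\<omega>. (\<Prod>b\<in>UNIV. case_bool ?U ?V b \<omega>) \<partial>M) = (\<Prod>b\<in>UNIV. \<integral>\<^sup>+\<omega>. case_bool ?U ?V b \<omega> \<partial>M)"
    by (intro indep_vars_nn_integral ind) auto
  moreover have "(\<Prod>b\<in>UNIV. case_bool ?U ?V b \<omega>) = ennreal (exp (Re (c * Z \<omega>)))" for \<omega>
    by (simp add: UNIV_bool flip: ennreal_mult exp_add)
  ultimately have "(\<integral>\<^sup>+\<omega>. ennreal (exp (Re (c * Z \<omega>))) \<partial>M) = (\<integral>\<^sup>+\<omega>. ?U \<omega> \<partial>M) * (\<integral>\<^sup>+\<omega>. ?V \<omega> \<partial>M)"
    by (simp only: UNIV_bool) (simp add: mult.commute)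
  also have "\<dots> = ennreal (exp ((Re c)\<^sup>2 * (\<sigma> / sqrt 2)\<^sup>2 / 2)) * ennreal (exp ((- Im c)\<^sup>2 * (\<sigma> / sqrt 2)\<^sup>2 / 2))"
    using Z \<open>\<sigma> > 0\<close> by (subst (1 2) normal_mgf[of _ "\<sigma> / sqrt 2"]) (auto simp: circular_gaussian_def)
  also have "\<dots> = ennreal (exp (\<sigma>\<^sup>2 / 4 * (cmod c)\<^sup>2))"
    by (simp add: cmod_power2 power_divide algebra_simps flip: exp_add ennreal_mult)
  finally show ?thesis .
qed

text \<open>
  Real parts of unit-norm linear functionals of the noise are subgaussian with variance \<open>\<sigma>\<^sup>2 / 2\<close>.
  This is Chernoff's bound with the optimal parameter, and no factor \<open>2\<close> appears because the tail is
  one-sided.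
\<close>

lemma circular_gaussian_vector_tail:
  fixes \<eta> :: "'a \<Rightarrow> complex ^ 'n"
  assumes \<eta>: "circular_gaussian_vector \<sigma> \<eta>" and \<sigma>: "\<sigma> > 0"
    and c: "(\<Sum>j\<in>UNIV. (cmod (c j))\<^sup>2) = 1" and x: "x > 0"
  shows "prob {\<omega>\<in>space M. Re (\<Sum>j\<in>UNIV. c j * \<eta> \<omega> $ j) \<ge> x} \<le> exp (- (x\<^sup>2 / \<sigma>\<^sup>2))"
proof -
  have cg: "circular_gaussian \<sigma> (\<lambda>\<omega>. \<eta> \<omega> $ j)" for j using \<eta> by (simp add: circular_gaussian_vector_def)
  have ind: "indep_vars (\<lambda>_. borel) (\<lambda>j \<omega>. \<eta> \<omega> $ j) UNIV" using \<eta> by (simp add: circular_gaussian_vector_def)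
  have [measurable]: "(\<lambda>\<omega>. \<eta> \<omega> $ j) \<in> borel_measurable M" for j
    using ind by (auto simp: indep_vars_def)
  define s where "s = 2 * x / \<sigma>\<^sup>2"
  have s: "s > 0" using x \<sigma> by (simp add: s_def)
  let ?W = "\<lambda>\<omega>. Re (\<Sum>j\<in>UNIV. c j * \<eta> \<omega> $ j)"
  have "(\<integral>\<^sup>+\<omega>. ennreal (exp (s * ?W \<omega>)) \<partial>M) = (\<integral>\<^sup>+\<omega>. (\<Prod>j\<in>UNIV. ennreal (exp (Re (s * c j * \<eta> \<omega> $ j)))) \<partial>M)"
  proof (rule nn_integral_cong)
    fix \<omega>
    have "s * ?W \<omega> = (\<Sum>j\<in>UNIV. Re (s * c j * \<eta> \<omega> $ j))"
      by (simp only: Re_sum sum_distrib_left mult.assoc Re_of_real_mult)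
    then show "ennreal (exp (s * ?W \<omega>)) = (\<Prod>j\<in>UNIV. ennreal (exp (Re (s * c j * \<eta> \<omega> $ j))))"
      by (simp only: exp_sum[OF finite] prod_ennreal[OF exp_ge_zero])
  qed
  also have "\<dots> = (\<Prod>j\<in>UNIV. \<integral>\<^sup>+\<omega>. ennreal (exp (Re (s * c j * \<eta> \<omega> $ j))) \<partial>M)"
    by (intro indep_vars_nn_integral indep_vars_compose2[OF ind]) auto
  also have "\<dots> = (\<Prod>j\<in>UNIV. ennreal (exp (\<sigma>\<^sup>2 / 4 * (cmod (s * c j))\<^sup>2)))"
    by (intro prod.cong refl circular_gaussian_mgf cg \<sigma>)
  also have "\<dots> = ennreal (exp (\<Sum>j\<in>UNIV. \<sigma>\<^sup>2 / 4 * (cmod (s * c j))\<^sup>2))"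
    by (simp add: prod_ennreal exp_sum)
  also have "(\<Sum>j\<in>UNIV. \<sigma>\<^sup>2 / 4 * (cmod (s * c j))\<^sup>2) = \<sigma>\<^sup>2 / 4 * s\<^sup>2 * (\<Sum>j\<in>UNIV. (cmod (c j))\<^sup>2)"
    by (simp add: norm_mult power_mult_distrib sum_distrib_left mult_ac)
  finally have mgf: "(\<integral>\<^sup>+\<omega>. ennreal (exp (s * ?W \<omega>)) \<partial>M) = ennreal (exp (\<sigma>\<^sup>2 / 4 * s\<^sup>2))"
    using c by simp
  have "emeasure M {\<omega>\<in>space M. ?W \<omega> \<ge> x} \<le>
      ennreal (exp (- s * x)) * (\<integral>\<^sup>+\<omega>. ennreal (exp (s * ?W \<omega>)) * indicator (space M) \<omega> \<partial>M)"
    by (rule Chernoff_ineq_nn_integral_ge[OF s]) auto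
  also have "(\<integral>\<^sup>+\<omega>. ennreal (exp (s * ?W \<omega>)) * indicator (space M) \<omega> \<partial>M) = (\<integral>\<^sup>+\<omega>. ennreal (exp (s * ?W \<omega>)) \<partial>M)"
    by (intro nn_integral_cong) auto
  also have "ennreal (exp (- s * x)) * \<dots> = ennreal (exp (- s * x + \<sigma>\<^sup>2 / 4 * s\<^sup>2))"
    unfolding mgf exp_add by (simp flip: ennreal_mult)
  also have "- s * x + \<sigma>\<^sup>2 / 4 * s\<^sup>2 = - (x\<^sup>2 / \<sigma>\<^sup>2)"
  proof -
    have x_s: "x = \<sigma>\<^sup>2 / 2 * s" using \<sigma> by (simp add: s_def)
    have "x\<^sup>2 / \<sigma>\<^sup>2 = \<sigma>\<^sup>2 / 4 * s\<^sup>2"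
      using \<sigma> unfolding x_s by (simp add: power2_eq_square)
    moreover have "s * x = \<sigma>\<^sup>2 / 2 * s\<^sup>2"
      unfolding x_s by (simp add: power2_eq_square)
    ultimately show ?thesis by linarith
  qed
  finally show ?thesis unfolding emeasure_eq_measure by (simp only: ennreal_le_iff exp_ge_zero)
qed

lemma circular_gaussian_second_moment:
  assumes Z: "circular_gaussian \<sigma> Z" and \<sigma>: "\<sigma> > 0"
  shows "integrable M (\<lambda>\<omega>. (cmod (Z \<omega>))\<^sup>2)" "(\<integral>\<omega>. (cmod (Z \<omega>))\<^sup>2 \<partial>M) = \<sigma>\<^sup>2"
proof -
  have *: "integrable M (\<lambda>\<omega>. (V \<omega>)\<^sup>2)" "(\<integral>\<omega>. (V \<omega>)\<^sup>2 \<partial>M) = \<sigma>\<^sup>2 / 2"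
    if V: "distributed M lborel V (normal_density 0 (\<sigma> / sqrt 2))" for V
  proof -
    have pos: "\<sigma> / sqrt 2 > 0" using \<sigma> by simp
    show "integrable M (\<lambda>\<omega>. (V \<omega>)\<^sup>2)"
      using integrable_normal_moment[OF pos, of 0 2]
      by (subst distributed_integrable[OF V, symmetric]) auto
    show "(\<integral>\<omega>. (V \<omega>)\<^sup>2 \<partial>M) = \<sigma>\<^sup>2 / 2"
      using integral_normal_moment_even[OF pos, of 0 1] \<sigma>
      by (subst distributed_integral[OF V, symmetric]) (auto simp: power_divide)
  qed
  have "distributed M lborel (\<lambda>\<omega>. Re (Z \<omega>)) (normal_density 0 (\<sigma> / sqrt 2))"
    "distributed M lborel (\<lambda>\<omega>. Im (Z \<omega>)) (normal_density 0 (\<sigma> / sqrt 2))"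
    using Z by (auto simp: circular_gaussian_def)
  note * = *[OF this(1)] *[OF this(2)]
  show "integrable M (\<lambda>\<omega>. (cmod (Z \<omega>))\<^sup>2)" "(\<integral>\<omega>. (cmod (Z \<omega>))\<^sup>2 \<partial>M) = \<sigma>\<^sup>2"
    using * by (simp_all add: cmod_power2)
qed

lemma circular_gaussian_vector_second_moment:
  fixes \<eta> :: "'a \<Rightarrow> complex ^ 'n"
  assumes \<eta>: "circular_gaussian_vector \<sigma> \<eta>" and \<sigma>: "\<sigma> > 0"
  shows "(\<integral>\<omega>. (norm (\<eta> \<omega>))\<^sup>2 \<partial>M) = real CARD('n) * \<sigma>\<^sup>2"
proof -
  have cg: "circular_gaussian \<sigma> (\<lambda>\<omega>. \<eta> \<omega> $ j)" for j using \<eta> by (simp add: circular_gaussian_vector_def)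
  have "(norm v)\<^sup>2 = (\<Sum>j\<in>UNIV. (cmod (v $ j))\<^sup>2)" for v :: "complex ^ 'n"
    by (simp add: norm_vec_def L2_set_def sum_nonneg)
  then have "(\<integral>\<omega>. (norm (\<eta> \<omega>))\<^sup>2 \<partial>M) = (\<integral>\<omega>. (\<Sum>j\<in>UNIV. (cmod (\<eta> \<omega> $ j))\<^sup>2) \<partial>M)"
    by (simp only:)
  also have "\<dots> = (\<Sum>j\<in>UNIV. \<integral>\<omega>. (cmod (\<eta> \<omega> $ j))\<^sup>2 \<partial>M)"
    by (rule Bochner_Integration.integral_sum) (rule circular_gaussian_second_moment(1)[OF cg \<sigma>])
  also have "\<dots> = real CARD('n) * \<sigma>\<^sup>2"
    by (simp only: circular_gaussian_second_moment(2)[OF cg \<sigma>] sum_constant)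
  finally show ?thesis .
qed

end

section \<open>Deterministic analysis of one-step thresholding\<close>

text \<open>
  The first \<open>m\<close> entries of the decreasing list are all at least the \<open>m\<close>-th one.
\<close>

lemma mth_largest_nonneg_and_card_le:
  fixes b :: "complex ^ 'p"
  assumes m: "1 \<le> m" "m \<le> card (model_support b)"
  shows "0 \<le> mth_largest b m"
    and "m \<le> card {i \<in> model_support b. mth_largest b m \<le> cmod (b $ i)}"
proof -
  define V where "V = {#cmod (b $ i). i \<in># mset_set (model_support b)#}"
  define ys where "ys = rev (sorted_list_of_multiset V)"
  define v where "v = ys ! (m - 1)"
  have v: "mth_largest b m = v" by (simp add: mth_largest_def v_def ys_def V_def)
  have mset_ys: "mset ys = V" by (simp add: ys_def)
  then have len: "length ys = card (model_support b)"
    by (metis V_def size_image_mset size_mset size_mset_set)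
  have "v \<in> set ys" unfolding v_def using m len by (intro nth_mem) auto
  then have "v \<in># V" using mset_ys by (metis set_mset_mset)
  then show "0 \<le> mth_largest b m" by (auto simp: v V_def)
  have "sorted (rev ys)" by (simp add: ys_def)
  then have ge: "v \<le> y" if "y \<in> set (take m ys)" for y
    using that m len by (auto simp: v_def in_set_conv_nth sorted_rev_iff_nth_mono)
  have "m = length (filter (\<lambda>y. v \<le> y) (take m ys))"
    using m len ge by (simp add: filter_id_conv)
  also have "\<dots> \<le> length (filter (\<lambda>y. v \<le> y) (take m ys @ drop m ys))"
    by (simp only: filter_append length_append)
  also have "\<dots> = size (filter_mset (\<lambda>y. v \<le> y) V)"
    by (metis append_take_drop_id mset_filter mset_ys size_mset)
  also have "\<dots> = card {i \<in> model_support b. v \<le> cmod (b $ i)}"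
    by (simp add: V_def filter_mset_image_mset)
  finally show "m \<le> card {i \<in> model_support b. mth_largest b m \<le> cmod (b $ i)}"
    by (simp only: v)
qed

text \<open>
  Here \<open>b\<close> is the vector that has the value \<open>z j\<close> at the index \<open>f j\<close>, for the positions \<open>j\<close> in \<open>K\<close>, and
  vanishes elsewhere.
\<close>

context
  fixes b :: "complex ^ 'p" and f :: "'i \<Rightarrow> 'p" and K :: "'i set" and z :: "'i \<Rightarrow> complex"
  assumes finite_K: "finite K" and inj: "inj_on f K"
    and on: "\<And>j. j \<in> K \<Longrightarrow> b $ f j = z j" and off: "\<And>i. i \<notin> f ` K \<Longrightarrow> b $ i = 0"
begin

lemma sum_placed_eq: "(\<Sum>i\<in>UNIV. g i (b $ i)) = (\<Sum>j\<in>K. g (f j) (z j))"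
  if "\<And>i. g i 0 = (0 :: 'c :: comm_monoid_add)"
proof -
  have "(\<Sum>i\<in>UNIV. g i (b $ i)) = (\<Sum>i\<in>f ` K. g i (b $ i))"
    using that off by (intro sum.mono_neutral_right) auto
  also have "\<dots> = (\<Sum>j\<in>K. g (f j) (z j))"
    using inj on by (simp add: sum.reindex)
  finally show ?thesis .
qed

lemma norm_placed: "norm b = sqrt (\<Sum>j\<in>K. (cmod (z j))\<^sup>2)"
  unfolding norm_vec_def L2_set_def using sum_placed_eq[of "\<lambda>_ x. (cmod x)\<^sup>2"] by simp

lemma card_model_support_placed:
  assumes "\<And>j. j \<in> K \<Longrightarrow> z j \<noteq> 0"
  shows "card (model_support b) = card K"
proof -
  have "model_support b = f ` K"
    using on off assms by (auto simp: model_support_def)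
  then show ?thesis using inj by (simp add: card_image)
qed

text \<open>
  The proxy splits into signal, interference and projected noise, since the Gram matrix has unit
  diagonal.
\<close>

lemma proxy_decomposition:
  fixes X :: "complex ^ 'p ^ 'n" and v :: "complex ^ 'n"
  assumes unit: "norm (column i X) = 1"
  shows "(conj_transpose X *v (X *v b + v)) $ i =
    b $ i + (\<Sum>j\<in>K. z j * cross_correlation X i (f j)) + (\<Sum>m\<in>UNIV. cnj (X $ m $ i) * v $ m)"
proof -
  have diag: "hinner (column i X) (column i X) = 1"
  proof -
    have "(\<Sum>m\<in>UNIV. (cmod (X $ m $ i))\<^sup>2) = 1"
      using unit by (simp add: norm_vec_def L2_set_def column_def)
    then have "complex_of_real (\<Sum>m\<in>UNIV. (cmod (X $ m $ i))\<^sup>2) = 1" by simp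
    then show ?thesis
      unfolding of_real_sum complex_norm_square by (simp add: hinner_def column_def mult.commute)
  qed
  have "(conj_transpose X *v (X *v b)) $ i = (\<Sum>m\<in>UNIV. \<Sum>l\<in>UNIV. cnj (X $ m $ i) * (X $ m $ l * b $ l))"
    by (simp add: matrix_vector_mult_def conj_transpose_def sum_distrib_left)
  also have "\<dots> = (\<Sum>l\<in>UNIV. \<Sum>m\<in>UNIV. cnj (X $ m $ i) * (X $ m $ l * b $ l))"
    by (rule sum.swap)
  also have "\<dots> = (\<Sum>l\<in>UNIV. hinner (column i X) (column l X) * b $ l)"
    by (simp add: hinner_def column_def sum_distrib_right mult.assoc)
  also have "\<dots> = (\<Sum>l\<in>UNIV. (if l = i then b $ l else 0) + b $ l * cross_correlation X i l)"
    by (intro sum.cong) (auto simp: cross_correlation_def diag)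
  also have "\<dots> = b $ i + (\<Sum>l\<in>UNIV. b $ l * cross_correlation X i l)"
    by (simp add: sum.distrib)
  also have "(\<Sum>l\<in>UNIV. b $ l * cross_correlation X i l) = (\<Sum>j\<in>K. z j * cross_correlation X i (f j))"
    using sum_placed_eq[of "\<lambda>l x. x * cross_correlation X i l"] by simp
  finally have "(conj_transpose X *v (X *v b)) $ i = b $ i + (\<Sum>j\<in>K. z j * cross_correlation X i (f j))" .
  moreover have "(conj_transpose X *v v) $ i = (\<Sum>m\<in>UNIV. cnj (X $ m $ i) * v $ m)"
    by (simp add: matrix_vector_mult_def conj_transpose_def)
  ultimately show ?thesis
    by (simp add: matrix_vector_right_distrib)
qed

end

text \<open>
  If the proxy is within \<open>l\<close> of the signal everywhere, then entries above \<open>2 * l\<close> pass the threshold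
  \<open>l\<close> and zero entries do not.
\<close>

lemma thresholding_recovers:
  fixes b :: "complex ^ 'p" and X :: "complex ^ 'p ^ 'n"
  assumes err: "\<And>i. cmod ((conj_transpose X *v y) $ i - b $ i) \<le> l"
    and k: "card (model_support b) = k"
    and m: "m \<le> k" "m > 0 \<Longrightarrow> mth_largest b m > 2 * l"
  shows "OST X y l \<subseteq> model_support b" "card (model_support b - OST X y l) \<le> k - m"
proof -
  let ?f = "conj_transpose X *v y"
  show "OST X y l \<subseteq> model_support b"
  proof
    fix i assume "i \<in> OST X y l"
    then have "cmod (?f $ i) > l" by (simp add: OST_def)
    then have "b $ i \<noteq> 0" using err[of i] by auto
    then show "i \<in> model_support b" by (simp add: model_support_def)
  qed
  show "card (model_support b - OST X y l) \<le> k - m"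
  proof (cases "m = 0")
    case True
    have "card (model_support b - OST X y l) \<le> card (model_support b)"
      by (rule card_mono) auto
    then show ?thesis using True k by simp
  next
    case False
    define U where "U = {i \<in> model_support b. mth_largest b m \<le> cmod (b $ i)}"
    have "U \<subseteq> OST X y l"
    proof
      fix i assume "i \<in> U"
      then have "cmod (b $ i) > 2 * l" using m False by (simp add: U_def)
      moreover have "cmod (b $ i) \<le> cmod (?f $ i) + cmod (?f $ i - b $ i)"
        using norm_triangle_ineq4[of "?f $ i" "?f $ i - b $ i"] by simp
      ultimately show "i \<in> OST X y l" using err[of i] by (simp add: OST_def)
    qed
    then have "card (model_support b - OST X y l) \<le> card (model_support b - U)"
      by (intro card_mono) auto
    also have "\<dots> = k - card U"
      using k by (subst card_Diff_subset) (auto simp: U_def)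
    also have "\<dots> \<le> k - m"
      using mth_largest_nonneg_and_card_le(2)[of m b] m False k by (simp add: U_def)
    finally show ?thesis .
  qed
qed

text \<open>
  The two terms in the condition on the largest-to-average ratio are the squares of twice the two
  terms of the threshold, rescaled by \<open>k / Z\<^sup>2\<close>; here \<open>Z\<^sup>2 / \<sigma>\<^sup>2\<close> is \<open>n\<close> times the signal-to-noise
  ratio and \<open>q\<close> is the logarithm of the number of columns.
\<close>

lemma LAR_large_imp_mth_largest_large:
  fixes b :: "complex ^ 'p"
  assumes LAR: "LAR k b m > max (8 / (1 - t)\<^sup>2 * (2 * real k * q / (Z\<^sup>2 / \<sigma>\<^sup>2)))
      (400 / t\<^sup>2 * (2 * real k * q * \<mu>\<^sup>2))"
    and m: "1 \<le> m" "m \<le> card (model_support b)"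
    and b: "norm b = Z" "Z > 0" and "k > 0" "q \<ge> 0"
  shows "mth_largest b m > 2 * max (10 * \<mu> * Z * sqrt (2 * q) / t) (2 * \<sigma> * sqrt q / (1 - t))"
proof -
  define v where "v = mth_largest b m"
  have v: "v \<ge> 0" unfolding v_def by (rule mth_largest_nonneg_and_card_le[OF m])
  have scale: "v\<^sup>2 > c" if "LAR k b m > c * (real k / Z\<^sup>2)" for c
    using that b \<open>k > 0\<close> by (simp add: LAR_def v_def field_simps)
  have "v\<^sup>2 > 16 * \<sigma>\<^sup>2 * q / (1 - t)\<^sup>2"
    by (rule scale) (use LAR in \<open>simp add: field_simps\<close>)
  also have "16 * \<sigma>\<^sup>2 * q / (1 - t)\<^sup>2 = (2 * (2 * \<sigma> * sqrt q / (1 - t)))\<^sup>2"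
    using \<open>q \<ge> 0\<close> by (simp add: power_mult_distrib power_divide)
  finally have 1: "2 * (2 * \<sigma> * sqrt q / (1 - t)) < v" using v by (rule power2_less_imp_less)
  have "v\<^sup>2 > 400 / t\<^sup>2 * (2 * q * \<mu>\<^sup>2 * Z\<^sup>2)"
    by (rule scale) (use LAR b in \<open>simp add: field_simps\<close>)
  also have "400 / t\<^sup>2 * (2 * q * \<mu>\<^sup>2 * Z\<^sup>2) = (2 * (10 * \<mu> * Z * sqrt (2 * q) / t))\<^sup>2"
    using \<open>q \<ge> 0\<close> by (simp add: power_mult_distrib power_divide)
  finally have 2: "2 * (10 * \<mu> * Z * sqrt (2 * q) / t) < v" using v by (rule power2_less_imp_less)
  show ?thesis using 1 2 by (simp add: v_def)
qed

section \<open>Random permutations, uniform noise bounds and measurability\<close>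

context prob_space
begin

lemma uniform_perm_prob:
  fixes \<pi> :: "'a \<Rightarrow> nat \<Rightarrow> 'p::finite"
  assumes "uniform_perm \<pi>"
  shows "{\<omega>\<in>space M. P (\<pi> \<omega>)} \<in> events"
    and "prob {\<omega>\<in>space M. P (\<pi> \<omega>)} = real (card {f \<in> index_perms. P f}) / fact CARD('p)"
proof -
  let ?I = "index_perms :: (nat \<Rightarrow> 'p) set"
  have \<pi> [measurable]: "\<pi> \<in> measurable M (count_space ?I)"
    and distr: "distr M (count_space ?I) \<pi> = uniform_count_measure ?I"
    using assms by (auto simp: uniform_perm_def)
  note I = index_perms_eq_ext_bijections[where ?'p = 'p]
  have fin: "finite ?I" unfolding I by (rule finite_ext_bijections) auto
  have card: "card ?I = fact CARD('p)" unfolding I by (subst card_ext_bijections) auto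
  have vimage: "{\<omega>\<in>space M. P (\<pi> \<omega>)} = \<pi> -` {f \<in> ?I. P f} \<inter> space M"
    using measurable_space[OF \<pi>] by auto
  show "{\<omega>\<in>space M. P (\<pi> \<omega>)} \<in> events"
    unfolding vimage by (rule measurable_sets[OF \<pi>]) auto
  have "prob {\<omega>\<in>space M. P (\<pi> \<omega>)} = measure (distr M (count_space ?I) \<pi>) {f \<in> ?I. P f}"
    unfolding vimage by (rule measure_distr[symmetric]) auto
  also have "\<dots> = real (card {f \<in> ?I. P f}) / card ?I"
    unfolding distr using fin by (subst measure_uniform_count_measure) auto
  finally show "prob {\<omega>\<in>space M. P (\<pi> \<omega>)} = real (card {f \<in> ?I. P f}) / fact CARD('p)"
    by (simp add: card)
qed

lemma circular_gaussian_vector_component_measurable: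
  fixes \<eta> :: "'a \<Rightarrow> complex ^ 'n"
  assumes "circular_gaussian_vector \<sigma> \<eta>"
  shows "(\<lambda>\<omega>. \<eta> \<omega> $ m) \<in> borel_measurable M"
  using assms unfolding circular_gaussian_vector_def indep_vars_def by auto

text \<open>
  At deviation \<open>2 * \<sigma> * sqrt q\<close>, each of the four quarter turns of each functional has tail
  \<open>exp (- 2 * q)\<close>.
\<close>

lemma circular_gaussian_vector_uniform_tail:
  fixes \<eta> :: "'a \<Rightarrow> complex ^ 'n" and c :: "'p::finite \<Rightarrow> 'n \<Rightarrow> complex"
  assumes \<eta>: "circular_gaussian_vector \<sigma> \<eta>" and \<sigma>: "\<sigma> > 0" and q: "q > 0"
    and c: "\<And>i. (\<Sum>m\<in>UNIV. (cmod (c i m))\<^sup>2) = 1"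
  shows "{\<omega>\<in>space M. \<exists>i. cmod (\<Sum>m\<in>UNIV. c i m * \<eta> \<omega> $ m) > 2 * \<sigma> * sqrt q} \<in> events"
    and "prob {\<omega>\<in>space M. \<exists>i. cmod (\<Sum>m\<in>UNIV. c i m * \<eta> \<omega> $ m) > 2 * \<sigma> * sqrt q} \<le>
      4 * real CARD('p) * exp (- 2 * q)"
proof -
  note [measurable] = circular_gaussian_vector_component_measurable[OF \<eta>]
  show "{\<omega>\<in>space M. \<exists>i. cmod (\<Sum>m\<in>UNIV. c i m * \<eta> \<omega> $ m) > 2 * \<sigma> * sqrt q} \<in> events"
    by measurable
  define x where "x = sqrt 2 * \<sigma> * sqrt q"
  have x: "x > 0" "2 * \<sigma> * sqrt q = sqrt 2 * x" "x\<^sup>2 / \<sigma>\<^sup>2 = 2 * q"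
    using \<sigma> q by (simp_all add: x_def power_mult_distrib)
  define A where "A = (\<lambda>i u. {\<omega>\<in>space M. Re (\<Sum>m\<in>UNIV. (u * c i m) * \<eta> \<omega> $ m) \<ge> x})"
  have [measurable]: "A i u \<in> events" for i u unfolding A_def by measurable
  have tail: "prob (A i u) \<le> exp (- 2 * q)" if "u \<in> quarter_turns" for i u
  proof -
    have "(\<Sum>m\<in>UNIV. (cmod (u * c i m))\<^sup>2) = 1"
      using c quarter_turns_facts(3)[OF that] by (simp add: norm_mult)
    from circular_gaussian_vector_tail[OF \<eta> \<sigma> this x(1)] show ?thesis by (simp add: A_def x(3))
  qed
  have "{\<omega>\<in>space M. \<exists>i. cmod (\<Sum>m\<in>UNIV. c i m * \<eta> \<omega> $ m) > 2 * \<sigma> * sqrt q}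
      \<subseteq> (\<Union>(i, u) \<in> UNIV \<times> quarter_turns. A i u)"
  proof safe
    fix \<omega> i assume \<omega>: "\<omega> \<in> space M" and "cmod (\<Sum>m\<in>UNIV. c i m * \<eta> \<omega> $ m) > 2 * \<sigma> * sqrt q"
    then have "sqrt 2 * x < cmod (\<Sum>m\<in>UNIV. c i m * \<eta> \<omega> $ m)" by (simp only: x(2))
    from exists_quarter_turn_Re_ge[OF this] x(1) obtain u where u: "u \<in> quarter_turns"
      "Re (u * (\<Sum>m\<in>UNIV. c i m * \<eta> \<omega> $ m)) \<ge> x" by auto
    then have "\<omega> \<in> A i u" using \<omega> by (simp only: A_def sum_distrib_left mult.assoc mem_Collect_eq)
    then show "\<omega> \<in> (\<Union>(i, u) \<in> UNIV \<times> quarter_turns. A i u)" using u by auto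
  qed
  then have "prob {\<omega>\<in>space M. \<exists>i. cmod (\<Sum>m\<in>UNIV. c i m * \<eta> \<omega> $ m) > 2 * \<sigma> * sqrt q} \<le>
      prob (\<Union>(i, u) \<in> UNIV \<times> quarter_turns. A i u)"
    by (rule finite_measure_mono) (auto simp: quarter_turns_facts)
  also have "\<dots> \<le> (\<Sum>(i, u) \<in> UNIV \<times> quarter_turns. prob (A i u))"
    unfolding case_prod_unfold by (intro finite_measure_subadditive_finite) (auto simp: quarter_turns_facts)
  also have "\<dots> \<le> (\<Sum>(i, u) \<in> (UNIV :: 'p set) \<times> quarter_turns. exp (- 2 * q))"
    by (intro sum_mono) (auto simp only: case_prod_conv mem_Times_iff fst_conv snd_conv split: prod.split intro!: tail)
  also have "\<dots> = real CARD('p) * real (card quarter_turns) * exp (- 2 * q)"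
    by (simp add: case_prod_unfold card_cartesian_product)
  also have "\<dots> \<le> real CARD('p) * 4 * exp (- 2 * q)"
    using quarter_turns_facts(2) by (intro mult_right_mono mult_left_mono) auto
  finally show "prob {\<omega>\<in>space M. \<exists>i. cmod (\<Sum>m\<in>UNIV. c i m * \<eta> \<omega> $ m) > 2 * \<sigma> * sqrt q} \<le>
      4 * real CARD('p) * exp (- 2 * q)" by (simp add: mult_ac)
qed

text \<open>
  The permutation and the output of the algorithm take finitely many values, so any condition on the
  pair is a finite union of measurable sets.
\<close>

lemma OST_event_measurable:
  fixes \<eta> :: "'a \<Rightarrow> complex ^ 'n" and X :: "complex ^ 'p ^ 'n"
  assumes \<pi> [measurable]: "\<pi> \<in> measurable M (count_space S)" and S: "finite S"
    and [measurable]: "\<And>m. (\<lambda>\<omega>. \<eta> \<omega> $ m) \<in> borel_measurable M"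
  shows "{\<omega>\<in>space M. Q (\<pi> \<omega>) (OST X (v (\<pi> \<omega>) + \<eta> \<omega>) l)} \<in> events"
proof -
  have out: "{\<omega>\<in>space M. \<pi> \<omega> = f \<and> OST X (v f + \<eta> \<omega>) l = T} \<in> events" if f: "f \<in> S" for f T
  proof -
    have "{\<omega>\<in>space M. \<pi> \<omega> = f \<and> OST X (v f + \<eta> \<omega>) l = T} =
        {\<omega>\<in>space M. \<pi> \<omega> = f} \<inter> {\<omega>\<in>space M. \<forall>i\<in>UNIV.
          (l < cmod (\<Sum>m\<in>UNIV. cnj (X $ m $ i) * (v f $ m + \<eta> \<omega> $ m))) = (i \<in> T)}"
      by (auto simp: OST_def matrix_vector_mult_def conj_transpose_def set_eq_iff)
    moreover have "{\<omega>\<in>space M. \<pi> \<omega> = f} = \<pi> -` {f} \<inter> space M" by auto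
    moreover have "\<pi> -` {f} \<inter> space M \<in> events" using f by (intro measurable_sets[OF \<pi>]) auto
    moreover have "{\<omega>\<in>space M. \<forall>i\<in>UNIV.
        (l < cmod (\<Sum>m\<in>UNIV. cnj (X $ m $ i) * (v f $ m + \<eta> \<omega> $ m))) = (i \<in> T)} \<in> events"
    proof (rule sets.sets_Collect_finite_All)
      fix i
      have "{\<omega>\<in>space M. l < cmod (\<Sum>m\<in>UNIV. cnj (X $ m $ i) * (v f $ m + \<eta> \<omega> $ m))} \<in> events"
        "{\<omega>\<in>space M. \<not> l < cmod (\<Sum>m\<in>UNIV. cnj (X $ m $ i) * (v f $ m + \<eta> \<omega> $ m))} \<in> events"
        by measurable
      then show "{\<omega>\<in>space M. (l < cmod (\<Sum>m\<in>UNIV. cnj (X $ m $ i) * (v f $ m + \<eta> \<omega> $ m))) = (i \<in> T)} \<in> events"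
        by (cases "i \<in> T") simp_all
    qed simp
    ultimately show ?thesis by auto
  qed
  have "{\<omega>\<in>space M. Q (\<pi> \<omega>) (OST X (v (\<pi> \<omega>) + \<eta> \<omega>) l)} =
      (\<Union>(f, T) \<in> {(f, T) \<in> S \<times> UNIV. Q f T}. {\<omega>\<in>space M. \<pi> \<omega> = f \<and> OST X (v f + \<eta> \<omega>) l = T})"
    using measurable_space[OF \<pi>] by auto
  moreover have "finite {(f, T) \<in> S \<times> (UNIV :: 'p set set). Q f T}"
    by (rule finite_subset[of _ "S \<times> UNIV"]) (use S in auto)
  ultimately show ?thesis using out by (auto intro!: sets.finite_UN)
qed

end

section \<open>Recovery by one-step thresholding\<close>

theorem theorem5:
  fixes X :: "complex ^ 'p ^ 'n"
    and n p k :: nat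
    and z :: "nat \<Rightarrow> complex"
    and M :: "'a measure"
    and \<pi> :: "'a \<Rightarrow> nat \<Rightarrow> 'p"
    and \<beta> :: "'a \<Rightarrow> complex ^ 'p"
    and \<eta> y :: "'a \<Rightarrow> complex ^ 'n"
    and \<sigma> t \<mu> :: real
    and SNR lam :: "'a \<Rightarrow> real"
    and Mrec :: "'a \<Rightarrow> nat"
  assumes n_def: "n = CARD('n)" and p_def: "p = CARD('p)"
    and dims: "0 < k" "k < n" "n \<le> p"
    and unit_columns: "\<And>i. norm (column i X) = 1"
    and coherence: "coherence_property X"
    and p_ge: "p \<ge> 128"
    and prob: "prob_space M"
    and sigma_pos: "\<sigma> > 0"
    and noise: "prob_space.circular_gaussian_vector M \<sigma> \<eta>"
    and perm: "prob_space.uniform_perm M \<pi>"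
    and indep: "prob_space.indep_rvs M (count_space index_perms) \<pi> borel \<eta>"
    and z_nonzero: "\<And>i. i \<in> {1..k} \<Longrightarrow> z i \<noteq> 0"
    and signal_on: "\<And>\<omega> i. \<omega> \<in> space M \<Longrightarrow> i \<in> {1..k} \<Longrightarrow> \<beta> \<omega> $ \<pi> \<omega> i = z i"
    and signal_off: "\<And>\<omega> j. \<omega> \<in> space M \<Longrightarrow> j \<notin> \<pi> \<omega> ` {1..k} \<Longrightarrow> \<beta> \<omega> $ j = 0"
    and y_def: "\<And>\<omega>. \<omega> \<in> space M \<Longrightarrow> y \<omega> = X *v \<beta> \<omega> + \<eta> \<omega>"
    and t_range: "0 < t" "t < 1"
    and sparsity: "real k \<le> real n / (2 * ln (real p))"
    and mu_def: "\<mu> = worst_case_coherence X"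
    and SNR_def: "\<And>\<omega>. \<omega> \<in> space M \<Longrightarrow> SNR \<omega> = snr M \<eta> (\<beta> \<omega>)"
    and lam_def: "\<And>\<omega>. \<omega> \<in> space M \<Longrightarrow>
      lam \<omega> = max (1 / t * 10 * \<mu> * sqrt (real n * SNR \<omega>)) (1 / (1 - t) * sqrt 2)
              * sqrt (2 * \<sigma>\<^sup>2 * ln (real p))"
    and Mrec_def: "\<And>\<omega>. \<omega> \<in> space M \<Longrightarrow>
      Mrec \<omega> = Max (insert 0 {m \<in> {1..k}. LAR k (\<beta> \<omega>) m >
        max (8 / (1 - t)\<^sup>2 * (2 * real k * ln (real p) / (real n * SNR \<omega>)))
            (400 / t\<^sup>2 * (2 * real k * ln (real p) * \<mu>\<^sup>2))})"
  shows "measure M {\<omega> \<in> space M.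
            OST X (y \<omega>) (lam \<omega>) \<subseteq> model_support (\<beta> \<omega>) \<and>
            card (model_support (\<beta> \<omega>) - OST X (y \<omega>) (lam \<omega>)) \<le> k - Mrec \<omega>}
         > 1 - 6 / real p"
proof -
  interpret prob_space M by (rule prob)
  define q where "q = ln (real p)"
  define L where "L = sqrt (2 * q)"
  define Z where "Z = sqrt (\<Sum>j\<in>{1..k}. (cmod (z j))\<^sup>2)"
  define l where "l = max (10 * \<mu> * Z * L / t) (2 * \<sigma> * sqrt q / (1 - t))"
  \<comment> \<open>The signal as a function of the permutation alone; needed to see that the event is measurable.\<close>
  define place :: "(nat \<Rightarrow> 'p) \<Rightarrow> complex ^ 'p"
    where "place = (\<lambda>f. \<chi> i. \<Sum>j\<in>{1..k}. if f j = i then z j else 0)"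
  define rec where "rec = (\<lambda>b :: complex ^ 'p. Max (insert 0 {m \<in> {1..k}. LAR k b m >
    max (8 / (1 - t)\<^sup>2 * (2 * real k * q / (Z\<^sup>2 / \<sigma>\<^sup>2))) (400 / t\<^sup>2 * (2 * real k * q * \<mu>\<^sup>2))}))"
  let ?good = "\<lambda>b T. T \<subseteq> model_support b \<and> card (model_support b - T) \<le> k - rec b"

  have q: "q \<ge> 1"
  proof -
    have "exp 1 \<le> real p" using exp_le p_ge by linarith
    then show ?thesis using p_ge by (simp add: q_def ln_ge_iff)
  qed
  then have L: "L \<ge> 1" "L\<^sup>2 = 2 * q" by (simp_all add: L_def)
  have k_le: "2 * k \<le> p"
  proof -
    have "real k \<le> real n / (2 * 1)"
      using q by (intro order_trans[OF sparsity] divide_left_mono) (auto simp: q_def)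
    then show ?thesis using dims by linarith
  qed
  have Z: "Z > 0"
  proof -
    have "(\<Sum>j\<in>{1..k}. (cmod (z j))\<^sup>2) > 0"
      using dims z_nonzero by (intro sum_pos) auto
    then show ?thesis by (simp add: Z_def)
  qed
  have avg: "average_coherence X \<le> worst_case_coherence X / sqrt (real CARD('n))"
    using coherence by (simp add: coherence_property_def)

  have perm_mem: "\<pi> \<omega> \<in> index_perms" if "\<omega> \<in> space M" for \<omega>
    using perm that unfolding uniform_perm_def by (auto dest: measurable_space)
  have inj: "inj_on (\<pi> \<omega>) {1..k}" if "\<omega> \<in> space M" for \<omega>
    using perm_mem[OF that] dims p_def
    by (auto simp: index_perms_def bij_betw_def intro: inj_on_subset)
  note placed = inj signal_on signal_off
  have norm_b: "norm (\<beta> \<omega>) = Z" if "\<omega> \<in> space M" for \<omega>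
    unfolding Z_def by (rule norm_placed) (use placed[OF that] in auto)
  have card_b: "card (model_support (\<beta> \<omega>)) = k" if "\<omega> \<in> space M" for \<omega>
    using card_model_support_placed[of "{1..k}" "\<pi> \<omega>" "\<beta> \<omega>" z] placed[OF that] z_nonzero by simp
  have place_b: "\<beta> \<omega> = place (\<pi> \<omega>)" if \<omega>: "\<omega> \<in> space M" for \<omega>
  proof (rule vec_eq_iff[THEN iffD2], rule allI)
    fix i
    show "\<beta> \<omega> $ i = place (\<pi> \<omega>) $ i"
    proof (cases "i \<in> \<pi> \<omega> ` {1..k}")
      case True
      then obtain j where j: "j \<in> {1..k}" "i = \<pi> \<omega> j" by auto
      have "place (\<pi> \<omega>) $ i = (\<Sum>j'\<in>{1..k}. if j' = j then z j' else 0)"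
        unfolding place_def vec_lambda_beta j(2)
        by (intro sum.cong refl) (simp only: inj_on_eq_iff[OF inj[OF \<omega>] _ j(1)])
      also have "\<dots> = \<beta> \<omega> $ i"
        using j signal_on[OF \<omega> j(1)] by simp
      finally show ?thesis ..
    next
      case False
      then show ?thesis
        using signal_off[OF \<omega> False] by (auto simp: place_def intro!: sum.neutral)
    qed
  qed

  have n_SNR: "real n * SNR \<omega> = Z\<^sup>2 / \<sigma>\<^sup>2" if "\<omega> \<in> space M" for \<omega>
    using circular_gaussian_vector_second_moment[OF noise sigma_pos] dims
    by (simp add: SNR_def[OF that] snr_def norm_b[OF that] n_def)
  have lam: "lam \<omega> = l" if "\<omega> \<in> space M" for \<omega>
  proof -
    define r where "r = sqrt (2 * \<sigma>\<^sup>2 * q)"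
    have r: "r = \<sigma> * L" "r = \<sigma> * (sqrt 2 * sqrt q)" "r \<ge> 0"
      using sigma_pos q by (simp_all add: r_def L_def real_sqrt_mult)
    have "sqrt (Z\<^sup>2 / \<sigma>\<^sup>2) = Z / \<sigma>"
      using sigma_pos Z by (simp add: real_sqrt_divide)
    then have "1 / t * 10 * \<mu> * sqrt (Z\<^sup>2 / \<sigma>\<^sup>2) * r = 10 * \<mu> * Z * L / t"
      unfolding r(1) using sigma_pos by simp
    moreover have "1 / (1 - t) * sqrt 2 * r = 2 * \<sigma> * sqrt q / (1 - t)"
      unfolding r(2) by simp
    ultimately show ?thesis
      unfolding lam_def[OF that] n_SNR[OF that] l_def q_def[symmetric] r_def[symmetric]
      by (simp only: max_mult_distrib_right r(3) if_True)
  qed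
  have rec: "Mrec \<omega> = rec (\<beta> \<omega>)" if "\<omega> \<in> space M" for \<omega>
    by (simp add: Mrec_def[OF that] rec_def n_SNR[OF that] q_def)

  define E where "E = {\<omega>\<in>space M. ?good (\<beta> \<omega>) (OST X (y \<omega>) (lam \<omega>))}"
  have "E = {\<omega>\<in>space M. ?good (place (\<pi> \<omega>)) (OST X (X *v place (\<pi> \<omega>) + \<eta> \<omega>) l)}"
    unfolding E_def by (intro Collect_cong conj_cong refl) (simp_all add: place_b y_def lam)
  moreover have "\<dots> \<in> events"
  proof (rule OST_event_measurable[where Q = "\<lambda>f. ?good (place f)" and v = "\<lambda>f. X *v place f"])
    show "\<pi> \<in> measurable M (count_space index_perms)" using perm by (simp add: uniform_perm_def)
    show "finite (index_perms :: (nat \<Rightarrow> 'p) set)"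
      unfolding index_perms_eq_ext_bijections by (rule finite_ext_bijections) auto
    show "(\<lambda>\<omega>. \<eta> \<omega> $ m) \<in> borel_measurable M" for m
      by (rule circular_gaussian_vector_component_measurable[OF noise])
  qed
  ultimately have E_meas: "E \<in> events" by simp

  define cross where "cross = (\<lambda>f i. \<Sum>j\<in>{1..k}. z j * cross_correlation X i (f j))"
  define proj where "proj = (\<lambda>\<omega> i. \<Sum>m\<in>UNIV. cnj (X $ m $ i) * \<eta> \<omega> $ m)"
  \<comment> \<open>The two exceptional events: large interference, caused by the support, and large noise.\<close>
  define B1 where "B1 = {\<omega>\<in>space M. \<exists>i. cmod (cross (\<pi> \<omega>) i) > 10 * \<mu> * Z * L}"
  define B2 where "B2 = {\<omega>\<in>space M. \<exists>i. cmod (proj \<omega> i) > 2 * \<sigma> * sqrt q}"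

  have B1: "B1 \<in> events" "prob B1 \<le> 4 * real p * exp (- 8 * q)"
  proof -
    show "B1 \<in> events" unfolding B1_def by (rule uniform_perm_prob(1)[OF perm])
    have "prob B1 = real (card {f \<in> index_perms. \<exists>i. cmod (cross f i) > 10 * \<mu> * Z * L}) / fact CARD('p)"
      unfolding B1_def by (rule uniform_perm_prob(2)[OF perm])
    also have "\<dots> \<le> 4 * real CARD('p) * exp (- 4 * L\<^sup>2) * fact CARD('p) / fact CARD('p)"
      unfolding cross_def mu_def using dims k_le n_def p_def Z L
      by (intro divide_right_mono card_cross_correlation_large_le[OF avg]) (auto simp: Z_def)
    finally show "prob B1 \<le> 4 * real p * exp (- 8 * q)"
      by (simp add: p_def L(2))
  qed
  have B2: "B2 \<in> events" "prob B2 \<le> 4 * real p * exp (- 2 * q)"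
  proof -
    have unit: "(\<Sum>m\<in>UNIV. (cmod (cnj (X $ m $ i)))\<^sup>2) = 1" for i
      using unit_columns[of i] by (simp add: norm_vec_def L2_set_def column_def)
    have "q > 0" using q by simp
    note tail = circular_gaussian_vector_uniform_tail[OF noise sigma_pos this unit]
    show "B2 \<in> events" "prob B2 \<le> 4 * real p * exp (- 2 * q)"
      unfolding B2_def proj_def p_def by (rule tail)+
  qed

  have good: "\<omega> \<in> E" if \<omega>: "\<omega> \<in> space M" "\<omega> \<notin> B1" "\<omega> \<notin> B2" for \<omega>
  proof -
    have err: "cmod ((conj_transpose X *v y \<omega>) $ i - \<beta> \<omega> $ i) \<le> l" for i
    proof -
      have "(conj_transpose X *v (X *v \<beta> \<omega> + \<eta> \<omega>)) $ i = \<beta> \<omega> $ i + cross (\<pi> \<omega>) i + proj \<omega> i"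
        unfolding cross_def proj_def
        by (rule proxy_decomposition) (use placed[OF \<omega>(1)] unit_columns in auto)
      then have "cmod ((conj_transpose X *v y \<omega>) $ i - \<beta> \<omega> $ i) \<le> cmod (cross (\<pi> \<omega>) i) + cmod (proj \<omega> i)"
        using norm_triangle_ineq by (simp add: y_def[OF \<omega>(1)])
      also have "\<dots> \<le> 10 * \<mu> * Z * L + 2 * \<sigma> * sqrt q"
        using \<omega> by (intro add_mono) (auto simp: B1_def B2_def not_less)
      \<comment> \<open>The parameter t divides the threshold between interference and noise.\<close>
      also have "\<dots> \<le> t * l + (1 - t) * l"
      proof (rule add_mono)
        have "10 * \<mu> * Z * L = t * (10 * \<mu> * Z * L / t)" using t_range by simp
        also have "\<dots> \<le> t * l" unfolding l_def using t_range by (intro mult_left_mono) auto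
        finally show "10 * \<mu> * Z * L \<le> t * l" .
        have "2 * \<sigma> * sqrt q = (1 - t) * (2 * \<sigma> * sqrt q / (1 - t))" using t_range by simp
        also have "\<dots> \<le> (1 - t) * l" unfolding l_def using t_range by (intro mult_left_mono) auto
        finally show "2 * \<sigma> * sqrt q \<le> (1 - t) * l" .
      qed
      also have "\<dots> = l" by (simp add: algebra_simps)
      finally show ?thesis .
    qed
    let ?R = "{m \<in> {1..k}. LAR k (\<beta> \<omega>) m >
      max (8 / (1 - t)\<^sup>2 * (2 * real k * q / (Z\<^sup>2 / \<sigma>\<^sup>2))) (400 / t\<^sup>2 * (2 * real k * q * \<mu>\<^sup>2))}"
    have "rec (\<beta> \<omega>) \<in> insert 0 ?R" unfolding rec_def by (rule Max_in) auto
    then have "rec (\<beta> \<omega>) \<le> k" and R: "rec (\<beta> \<omega>) \<in> ?R" if "rec (\<beta> \<omega>) > 0"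
      using that by auto
    then have rec_le: "rec (\<beta> \<omega>) \<le> k" by (cases "rec (\<beta> \<omega>) > 0") auto
    have large: "mth_largest (\<beta> \<omega>) (rec (\<beta> \<omega>)) > 2 * l" if "rec (\<beta> \<omega>) > 0"
      unfolding l_def L_def
      by (rule LAR_large_imp_mth_largest_large[where k = k])
        (use R[OF that] card_b[OF \<omega>(1)] norm_b[OF \<omega>(1)] Z dims sigma_pos q t_range in auto)
    show ?thesis
      unfolding E_def lam[OF \<omega>(1)]
      using thresholding_recovers[OF err card_b[OF \<omega>(1)] rec_le large] \<omega> lam[OF \<omega>(1)] by simp
  qed
  have "1 - prob E = prob (space M - E)"
    by (rule prob_compl[OF E_meas, symmetric])
  also have "\<dots> \<le> prob (B1 \<union> B2)"
    using good B1 B2 by (intro finite_measure_mono) auto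
  also have "\<dots> \<le> prob B1 + prob B2"
    using B1 B2 by (intro measure_Un_le) auto
  \<comment> \<open>Since exp (- q) = 1 / p, the noise costs 4 / p, and already exp (- 3 * q) makes the interference negligible.\<close>
  also have "\<dots> \<le> 4 * real p * exp (- 3 * q) + 4 * real p * exp (- 2 * q)"
    using B1(2) B2(2) q by (intro add_mono order_trans[OF B1(2)] mult_left_mono) auto
  also have "\<dots> = 4 / (real p)\<^sup>2 + 4 / real p"
  proof -
    have "exp q = real p" using p_ge by (simp add: q_def)
    then have "exp (- q) = 1 / real p" by (simp add: exp_minus divide_inverse)
    moreover have "exp (- 2 * q) = exp (- q) * exp (- q)" "exp (- 3 * q) = exp (- q) * exp (- q) * exp (- q)"
      by (simp_all flip: exp_add)
    ultimately show ?thesis using p_ge by (simp add: power2_eq_square)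
  qed
  also have "\<dots> < 6 / real p"
    using p_ge by (simp add: field_simps power2_eq_square)
  finally have "prob E > 1 - 6 / real p" by simp
  moreover have "E = {\<omega> \<in> space M. OST X (y \<omega>) (lam \<omega>) \<subseteq> model_support (\<beta> \<omega>) \<and>
      card (model_support (\<beta> \<omega>) - OST X (y \<omega>) (lam \<omega>)) \<le> k - Mrec \<omega>}"
    unfolding E_def by (intro Collect_cong conj_cong refl) (simp_all add: rec)
  ultimately show ?thesis by (simp only:)
qed

end
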